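(* Let $d>4$, $\gamma>2$ and $\tau>0$. There exist constants $c_1,c_2,c_3>0$, depending only on $\gamma,\tau,d$, such that the following holds. Let $\mathbb{P}^\star$ be a zero mean probability distribution on $\mathbb{R}^d$ with covariance matrix $\bm{\Sigma}^\star\succ 0$ and $\mathbb{E}_{\mathbb{P}^\star}[e^{\|\bm{\xi}\|^\gamma}]\le\tau$, let $N\in\mathbb{N}$ with $N\ge 1$, let $\bm{\xi}^1,\dots,\bm{\xi}^N$ be i.i.d. samples from $\mathbb{P}^\star$, let $\hat{\mathbb{P}}$ be the associated centered empirical distribution with covariance $\hat{\bm{\Sigma}}$, and set $\alpha^\star=\lambda_{\min}(\bm{\Sigma}^\star)^{-1/2}$ and $\hat\beta=\lambda_{\max}(\hat{\bm{\Sigma}})^{1/2}$. For $\delta\in(0,1]$ define $$\rho_w^\star(N,\delta)=\begin{cases}\left(\frac{\log(c_1/\delta)}{c_2N}\right)^{1/d} & \text{if } N\ge \frac{\log(c_1/\delta)}{c_2},\\ \left(\frac{\log(c_1/\delta)}{c_2N}\right)^{1/\gamma}&\text{otherwise,}\end{cases}\qquad \rho_\mu^\star(N,\delta)=\sqrt{\frac{4K_{\gamma,\tau}^2\left(\log(2/\delta)+d\log 5\right)}{c_3N}},$$ where $K_{\gamma,\tau}=\sqrt{\frac{2}{\gamma}\max\{1,\frac{\log M_{\gamma,\tau}}{\log 2}\}}$ and $M_{\gamma,\tau}=\tau e^{(\gamma-2)/2}$, and let $\rho^\star(N,\zeta)=\rho_w^\star(N,\zeta/2)+\rho_\mu^\star(N,\zeta/2)$.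 Then, for any $\zeta\in(0,1]$ and any Wasserstein radius $\rho\ge\rho^\star(N,\zeta)$, with $\bar\rho=\rho(2\hat\beta+\rho)$, $$J(\mathbf{K}_{\mathrm{dr}}^\star,\mathbb{P}^\star)\le J(\mathbf{K}^\star,\mathbb{P}^\star)\left(1+2\bar\rho\,{\alpha^\star}^2\right)$$ with probability at least $1-\zeta$ over the draw of the samples. Here $\mathbf{K}^\star$ is the $\mathbb{P}^\star$-optimal (oracle) controller and $\mathbf{K}^\star_{\mathrm{dr}}$ is the Wasserstein distributionally robust optimal controller of radius $\rho$, both defined in the context.
   Context: System. Fix a horizon $T\in\mathbb{N}$ and matrices $A_t,B_t,C_t$ of sizes $n\times n$, $n\times m$, $p\times n$. The dynamics are $x_{t+1}=A_tx_t+B_tu_t+w_t$, $y_t=C_tx_t+v_t$. Write $\mathbf{x}=(x_0,\dots,x_{T-1})$, $\mathbf{u}=(u_0,\dots,u_{T-1})$, $\mathbf{y}=(y_0,\dots,y_{T-1})$, $\mathbf{w}=(x_0,w_0,\dots,w_{T-2})$, $\mathbf{v}=(v_0,\dots,v_{T-1})$, and $\bm{\xi}=(\mathbf{w},\mathbf{v})\in\mathbb{R}^d$, $d=(n+p)T$, for the vector of all random exogenous quantities. Controllers. $\mathcal{K}$ is the set of lower block-triangular (causal) matrices $\mathbf{K}$ of size $mT\times pT$ (with $m\times p$ blocks); controller $\mathbf{K}\in\mathcal{K}$ applies $\mathbf{u}=\mathbf{K}\mathbf{y}$, so that $\mathbf{x}$ and $\mathbf{u}$ are linear functions of $\bm{\xi}$.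 Cost. Fix symmetric matrices $\mathbf{Q}\succeq0$ and $\mathbf{R}\succ0$ of sizes $nT$ and $mT$. Let $\mathcal{P}$ be the set of zero mean probability distributions on $\mathbb{R}^d$. For $\mathbb{P}\in\mathcal{P}$, $J(\mathbf{K},\mathbb{P})=\mathbb{E}_{\mathbb{P}}[\mathbf{x}^\top\mathbf{Q}\mathbf{x}+\mathbf{u}^\top\mathbf{R}\mathbf{u}]$ where $\bm{\xi}\sim\mathbb{P}$ and $\mathbf{u}=\mathbf{K}\mathbf{y}$. Oracle controller: $\mathbf{K}^\star\in\arg\min_{\mathbf{K}\in\mathcal{K}}J(\mathbf{K},\mathbb{P}^\star)$. Centered empirical law: $\hat{\mathbb{P}}=\frac1N\sum_{k=1}^N\delta(\bm{\xi}^k-\bar{\bm{\xi}})$, where $\delta(\cdot)$ denotes a Dirac mass at the given point and $\bar{\bm{\xi}}=\frac1N\sum_{k=1}^N\bm{\xi}^k$; $\hat{\bm{\Sigma}}$ is its covariance matrix. Ambiguity set: $\mathbb{W}$ is the 2-Wasserstein distance on $\mathbb{R}^d$ with Euclidean ground norm, and $\mathbb{B}^\rho_{\mathbb{W}}(\hat{\mathbb{P}})=\{\mathbb{P}\in\mathcal{P}:\mathbb{W}(\hat{\mathbb{P}},\mathbb{P})\le\rho\}$. Distributionally robust controller: $\mathbf{K}^\star_{\mathrm{dr}}\in\arg\min_{\mathbf{K}\in\mathcal{K}}\sup_{\mathbb{P}\in\mathbb{B}^\rho_{\mathbb{W}}(\hat{\mathbb{P}})}J(\mathbf{K},\mathbb{P})$.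 $\|\cdot\|$ on vectors is the Euclidean norm; $\lambda_{\min},\lambda_{\max}$ denote extreme eigenvalues. *)

theory Defs
  imports
    "HOL-Probability.Probability"
    "Jordan_Normal_Form.Matrix"
    "Jordan_Normal_Form.Spectral_Radius"
begin

hide_const (open) Finite_Cartesian_Product.vec Finite_Cartesian_Product.mat
hide_const (open) Finite_Cartesian_Product.row Finite_Cartesian_Product.vec_nth Inner_Product.inner
unbundle no vec_syntax and no inner_syntax

definition psd_mat :: "nat \<Rightarrow> real mat \<Rightarrow> bool" where
  "psd_mat k A \<longleftrightarrow> A \<in> carrier_mat k k \<and> transpose_mat A = A \<and>
     (\<forall>v \<in> carrier_vec k. 0 \<le> v \<bullet> (A *\<^sub>v v))"

definition pd_mat :: "nat \<Rightarrow> real mat \<Rightarrow> bool" where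
  "pd_mat k A \<longleftrightarrow> A \<in> carrier_mat k k \<and> transpose_mat A = A \<and>
     (\<forall>v \<in> carrier_vec k. v \<noteq> 0\<^sub>v k \<longrightarrow> 0 < v \<bullet> (A *\<^sub>v v))"

definition lambda_min :: "real mat \<Rightarrow> real" where
  "lambda_min A = Min (spectrum A)"

definition lambda_max :: "real mat \<Rightarrow> real" where
  "lambda_max A = Max (spectrum A)"

record lq =
  hor :: nat
  nx :: nat
  nu :: nat
  ny :: nat
  matA :: "nat \<Rightarrow> real mat"
  matB :: "nat \<Rightarrow> real mat"
  matC :: "nat \<Rightarrow> real mat"
  matQ :: "real mat"
  matR :: "real mat"

definition lq_problem :: "lq \<Rightarrow> bool" where
  "lq_problem S \<longleftrightarrow>
     (\<forall>t < hor S. matA S t \<in> carrier_mat (nx S) (nx S) \<and>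
                  matB S t \<in> carrier_mat (nx S) (nu S) \<and>
                  matC S t \<in> carrier_mat (ny S) (nx S)) \<and>
     psd_mat (nx S * hor S) (matQ S) \<and> pd_mat (nu S * hor S) (matR S)"

definition noise_dim :: "lq \<Rightarrow> nat" where
  "noise_dim S = (nx S + ny S) * hor S"

definition block :: "nat \<Rightarrow> real vec \<Rightarrow> nat \<Rightarrow> real vec" where
  "block k z t = vec k (\<lambda>i. z $ (t * k + i))"

text \<open>An exogenous vector is a function on \<open>{..<noise_dim S}\<close>, stacking
  \<open>x\<^sub>0, w\<^sub>0, \<dots>, w\<^bsub>T-2\<^esub>\<close> followed by \<open>v\<^sub>0, \<dots>, v\<^bsub>T-1\<^esub>\<close>. Block \<open>0\<close> of \<open>exo_w\<close> is therefore the
  initial state, and block \<open>t + 1\<close> is the process noise \<open>w\<^sub>t\<close>.\<close>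

definition exo_w :: "lq \<Rightarrow> (nat \<Rightarrow> real) \<Rightarrow> real vec" where
  "exo_w S \<xi> = vec (nx S * hor S) \<xi>"

definition exo_v :: "lq \<Rightarrow> (nat \<Rightarrow> real) \<Rightarrow> real vec" where
  "exo_v S \<xi> = vec (ny S * hor S) (\<lambda>i. \<xi> (nx S * hor S + i))"

definition causal :: "lq \<Rightarrow> real mat set" where
  "causal S = {K \<in> carrier_mat (nu S * hor S) (ny S * hor S).
     \<forall>t < hor S. \<forall>s < hor S. t < s \<longrightarrow>
       (\<forall>i < nu S. \<forall>j < ny S. K $$ (t * nu S + i, s * ny S + j) = 0)}"

definition closed_loop ::
  "lq \<Rightarrow> real mat \<Rightarrow> (nat \<Rightarrow> real) \<Rightarrow> real vec \<Rightarrow> real vec \<Rightarrow> real vec \<Rightarrow> bool" where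
  "closed_loop S K \<xi> x u y \<longleftrightarrow>
     x \<in> carrier_vec (nx S * hor S) \<and>
     u \<in> carrier_vec (nu S * hor S) \<and>
     y \<in> carrier_vec (ny S * hor S) \<and>
     (0 < hor S \<longrightarrow> block (nx S) x 0 = block (nx S) (exo_w S \<xi>) 0) \<and>
     (\<forall>t. t + 1 < hor S \<longrightarrow>
        block (nx S) x (t + 1) =
          matA S t *\<^sub>v block (nx S) x t + matB S t *\<^sub>v block (nu S) u t
            + block (nx S) (exo_w S \<xi>) (t + 1)) \<and>
     (\<forall>t < hor S.
        block (ny S) y t = matC S t *\<^sub>v block (nx S) x t + block (ny S) (exo_v S \<xi>) t) \<and>
     u = K *\<^sub>v y"

text \<open>Well defined for causal \<open>K\<close>; see \<open>closed_loop_unique\<close> at the end.\<close>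

definition trajectory ::
  "lq \<Rightarrow> real mat \<Rightarrow> (nat \<Rightarrow> real) \<Rightarrow> real vec \<times> real vec \<times> real vec" where
  "trajectory S K \<xi> = (THE (x, u, y). closed_loop S K \<xi> x u y)"

definition lq_cost :: "lq \<Rightarrow> real mat \<Rightarrow> (nat \<Rightarrow> real) \<Rightarrow> real" where
  "lq_cost S K \<xi> =
     (case trajectory S K \<xi> of (x, u, y) \<Rightarrow> x \<bullet> (matQ S *\<^sub>v x) + u \<bullet> (matR S *\<^sub>v u))"

text \<open>The cost is nonnegative, so its expectation always exists in \<open>[0, \<infinity>]\<close>.\<close>

definition J :: "lq \<Rightarrow> real mat \<Rightarrow> (nat \<Rightarrow> real) measure \<Rightarrow> ennreal" where
  "J S K P = (\<integral>\<^sup>+ \<xi>. ennreal (lq_cost S K \<xi>) \<partial>P)"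

definition Rd :: "nat \<Rightarrow> (nat \<Rightarrow> real) measure" where
  "Rd d = (\<Pi>\<^sub>M i\<in>{..<d}. borel)"

definition zero_mean_dists :: "nat \<Rightarrow> (nat \<Rightarrow> real) measure set" where
  "zero_mean_dists d = {P. prob_space P \<and> sets P = sets (Rd d) \<and>
     (\<forall>i < d. integrable P (\<lambda>\<xi>. \<xi> i) \<and> (\<integral>\<xi>. \<xi> i \<partial>P) = 0)}"

definition cov_mat :: "nat \<Rightarrow> (nat \<Rightarrow> real) measure \<Rightarrow> real mat" where
  "cov_mat d P = mat d d (\<lambda>(i, j).
     \<integral>\<xi>. (\<xi> i - (\<integral>\<eta>. \<eta> i \<partial>P)) * (\<xi> j - (\<integral>\<eta>. \<eta> j \<partial>P)) \<partial>P)"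

text \<open>The law \<open>(1/N) \<Sum>\<^sub>k \<delta>(\<omega>\<^sub>k - mean)\<close> is the image of the uniform distribution on the sample
  indices; repeated atoms keep their multiplicity.\<close>

definition centered_empirical ::
  "nat \<Rightarrow> nat \<Rightarrow> (nat \<Rightarrow> nat \<Rightarrow> real) \<Rightarrow> (nat \<Rightarrow> real) measure" where
  "centered_empirical d N \<omega> =
     distr (uniform_count_measure {1..N}) (Rd d)
       (\<lambda>k. \<lambda>i\<in>{..<d}. \<omega> k i - (\<Sum>l=1..N. \<omega> l i) / real N)"

definition couplings ::
  "nat \<Rightarrow> (nat \<Rightarrow> real) measure \<Rightarrow> (nat \<Rightarrow> real) measure
    \<Rightarrow> ((nat \<Rightarrow> real) \<times> (nat \<Rightarrow> real)) measure set" where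
  "couplings d P Q = {\<pi>. sets \<pi> = sets (Rd d \<Otimes>\<^sub>M Rd d) \<and>
     distr \<pi> (Rd d) fst = P \<and> distr \<pi> (Rd d) snd = Q}"

definition ennreal_sqrt :: "ennreal \<Rightarrow> ennreal" where
  "ennreal_sqrt c = (if c = \<top> then \<top> else ennreal (sqrt (enn2real c)))"

definition wasserstein2 ::
  "nat \<Rightarrow> (nat \<Rightarrow> real) measure \<Rightarrow> (nat \<Rightarrow> real) measure \<Rightarrow> ennreal" where
  "wasserstein2 d P Q = ennreal_sqrt
     (INF \<pi> \<in> couplings d P Q.
        \<integral>\<^sup>+ (\<xi>, \<eta>). ennreal ((L2_set (\<lambda>i. \<xi> i - \<eta> i) {..<d})\<^sup>2) \<partial>\<pi>)"

definition wasserstein_ball ::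
  "nat \<Rightarrow> real \<Rightarrow> (nat \<Rightarrow> real) measure \<Rightarrow> (nat \<Rightarrow> real) measure set" where
  "wasserstein_ball d \<rho> P = {Q \<in> zero_mean_dists d. wasserstein2 d P Q \<le> ennreal \<rho>}"

definition oracle_controllers :: "lq \<Rightarrow> (nat \<Rightarrow> real) measure \<Rightarrow> real mat set" where
  "oracle_controllers S P = {K. is_arg_min (\<lambda>K. J S K P) (\<lambda>K. K \<in> causal S) K}"

definition dr_controllers :: "lq \<Rightarrow> real \<Rightarrow> (nat \<Rightarrow> real) measure \<Rightarrow> real mat set" where
  "dr_controllers S \<rho> P =
     {K. is_arg_min (\<lambda>K. SUP Q \<in> wasserstein_ball (noise_dim S) \<rho> P. J S K Q)
           (\<lambda>K. K \<in> causal S) K}"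

definition M_const :: "real \<Rightarrow> real \<Rightarrow> real" where
  "M_const \<gamma> \<tau> = \<tau> * exp ((\<gamma> - 2) / 2)"

definition K_const :: "real \<Rightarrow> real \<Rightarrow> real" where
  "K_const \<gamma> \<tau> = sqrt (2 / \<gamma> * max 1 (ln (M_const \<gamma> \<tau>) / ln 2))"

text \<open>In the first branch the logarithm may be negative when \<open>c1 < \<delta>\<close>; \<open>root d\<close> is then
  nonpositive, whereas \<open>powr\<close> would return an unrelated value. In the second branch the base
  exceeds \<open>1\<close>.\<close>

definition rho_w :: "nat \<Rightarrow> real \<Rightarrow> real \<Rightarrow> real \<Rightarrow> nat \<Rightarrow> real \<Rightarrow> real" where
  "rho_w d \<gamma> c1 c2 N \<delta> =
     (if real N \<ge> ln (c1 / \<delta>) / c2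
      then root d (ln (c1 / \<delta>) / (c2 * real N))
      else (ln (c1 / \<delta>) / (c2 * real N)) powr (1 / \<gamma>))"

definition rho_mu :: "nat \<Rightarrow> real \<Rightarrow> real \<Rightarrow> real \<Rightarrow> nat \<Rightarrow> real \<Rightarrow> real" where
  "rho_mu d \<gamma> \<tau> c3 N \<delta> =
     sqrt (4 * (K_const \<gamma> \<tau>)\<^sup>2 * (ln (2 / \<delta>) + real d * ln 5) / (c3 * real N))"

definition rho_star ::
  "nat \<Rightarrow> real \<Rightarrow> real \<Rightarrow> real \<Rightarrow> real \<Rightarrow> real \<Rightarrow> nat \<Rightarrow> real \<Rightarrow> real" where
  "rho_star d \<gamma> \<tau> c1 c2 c3 N \<zeta> =
     rho_w d \<gamma> c1 c2 N (\<zeta> / 2) + rho_mu d \<gamma> \<tau> c3 N (\<zeta> / 2)"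

lemma block_dim [simp]: "dim_vec (block k z t) = k" "block k z t \<in> carrier_vec k"
  by (simp_all add: block_def)

lemma idx_bound: "t < T \<Longrightarrow> i < k \<Longrightarrow> t * k + i < k * (T::nat)"
proof -
  assume "t < T" "i < k"
  then have "t * k + i < (t + 1) * k" by simp
  also have "\<dots> \<le> T * k" using \<open>t < T\<close> by (intro mult_le_mono1) simp
  finally show ?thesis by (simp add: mult.commute)
qed

lemma idx_split:
  assumes "(j::nat) < k * T" shows "j div k < T" "j mod k < k" "j = j div k * k + j mod k"
proof -
  have "k > 0" using assms by (cases k) auto
  then show "j mod k < k" by simp
  show "j div k < T" using assms by (simp add: less_mult_imp_div_less mult.commute)
  show "j = j div k * k + j mod k" by simp
qed

lemma vec_eq_blocks:
  assumes "x \<in> carrier_vec (k * T)" "x' \<in> carrier_vec (k * T)"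
    and "\<And>t. t < T \<Longrightarrow> block k x t = block k x' t"
  shows "x = x'"
proof (rule eq_vecI)
  fix j assume "j < dim_vec x'"
  then have j: "j < k * T" using assms by simp
  note s = idx_split[OF j]
  have "block k x (j div k) $ (j mod k) = block k x' (j div k) $ (j mod k)"
    using assms(3) s(1) by simp
  then show "x $ j = x' $ j" using s(2,3) by (simp add: block_def)
qed (use assms in simp)

definition cl_out :: "lq \<Rightarrow> (nat \<Rightarrow> real) \<Rightarrow> real vec \<Rightarrow> real vec" where
  "cl_out S \<xi> x = vec (ny S * hor S) (\<lambda>i.
     (matC S (i div ny S) *\<^sub>v block (nx S) x (i div ny S)
       + block (ny S) (exo_v S \<xi>) (i div ny S)) $ (i mod ny S))"

definition cl_step :: "lq \<Rightarrow> real mat \<Rightarrow> (nat \<Rightarrow> real) \<Rightarrow> real vec \<Rightarrow> real vec" where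
  "cl_step S K \<xi> x = vec (nx S * hor S) (\<lambda>i.
     case i div nx S of 0 \<Rightarrow> block (nx S) (exo_w S \<xi>) 0 $ (i mod nx S)
     | Suc t \<Rightarrow> (matA S t *\<^sub>v block (nx S) x t
          + matB S t *\<^sub>v block (nu S) (K *\<^sub>v cl_out S \<xi> x) t
          + block (nx S) (exo_w S \<xi>) (Suc t)) $ (i mod nx S))"

lemma cl_out_carrier: "cl_out S \<xi> x \<in> carrier_vec (ny S * hor S)"
  by (simp add: cl_out_def)

lemma cl_step_carrier: "cl_step S K \<xi> x \<in> carrier_vec (nx S * hor S)"
  by (simp add: cl_step_def)

lemma block_cl_out:
  assumes "t < hor S"
  shows "block (ny S) (cl_out S \<xi> x) t =
    matC S t *\<^sub>v block (nx S) x t + block (ny S) (exo_v S \<xi>) t"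
  by (rule eq_vecI) (use assms in \<open>auto simp: block_def cl_out_def idx_bound\<close>)

lemma block_cl_step_0:
  assumes "0 < hor S"
  shows "block (nx S) (cl_step S K \<xi> x) 0 = block (nx S) (exo_w S \<xi>) 0"
  by (rule eq_vecI)
    (use assms idx_bound[of 0 "hor S"] in \<open>auto simp: block_def cl_step_def\<close>)

lemma block_cl_step_Suc:
  assumes "Suc t < hor S"
  shows "block (nx S) (cl_step S K \<xi> x) (Suc t) =
    matA S t *\<^sub>v block (nx S) x t + matB S t *\<^sub>v block (nu S) (K *\<^sub>v cl_out S \<xi> x) t
      + block (nx S) (exo_w S \<xi>) (Suc t)" (is "_ = ?r")
proof (rule eq_vecI)
  fix i assume "i < dim_vec ?r"
  then have i: "i < nx S" by simp
  have "Suc t * nx S + i < nx S * hor S" using idx_bound[OF assms i] .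
  moreover have "(Suc t * nx S + i) div nx S = Suc t" "(Suc t * nx S + i) mod nx S = i"
    using i by (simp_all only: div_mult_self3 mod_mult_self3) auto
  ultimately have "cl_step S K \<xi> x $ (Suc t * nx S + i) = ?r $ i"
    unfolding cl_step_def by (simp only: index_vec nat.case)
  then show "block (nx S) (cl_step S K \<xi> x) (Suc t) $ i = ?r $ i"
    using i unfolding block_def[of _ "cl_step S K \<xi> x"] by (simp only: index_vec)
qed simp

lemma causal_block_cong:
  assumes K: "K \<in> causal S" and t: "t < hor S"
    and y: "y \<in> carrier_vec (ny S * hor S)" "y' \<in> carrier_vec (ny S * hor S)"
    and eq: "\<And>s. s \<le> t \<Longrightarrow> block (ny S) y s = block (ny S) y' s"
  shows "block (nu S) (K *\<^sub>v y) t = block (nu S) (K *\<^sub>v y') t"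
proof (rule eq_vecI)
  fix i assume "i < dim_vec (block (nu S) (K *\<^sub>v y') t)"
  then have i: "i < nu S" by simp
  have Kc: "K \<in> carrier_mat (nu S * hor S) (ny S * hor S)" using K by (simp add: causal_def)
  have r: "t * nu S + i < nu S * hor S" using idx_bound[OF t i] .
  have "K $$ (t * nu S + i, j) * y $ j = K $$ (t * nu S + i, j) * y' $ j"
    if j: "j < ny S * hor S" for j
  proof (cases "j div ny S \<le> t")
    case True
    then have "block (ny S) y (j div ny S) $ (j mod ny S)
        = block (ny S) y' (j div ny S) $ (j mod ny S)" using eq by simp
    then have "y $ j = y' $ j" using idx_split[OF j] by (simp add: block_def)
    then show ?thesis by simp
  next
    case False
    then have "t < j div ny S" by simp
    then have "K $$ (t * nu S + i, j div ny S * ny S + j mod ny S) = 0"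
      using K t i idx_split(1,2)[OF j] unfolding causal_def by blast
    then show ?thesis using idx_split(3)[OF j] by simp
  qed
  then have "row K (t * nu S + i) \<bullet> y = row K (t * nu S + i) \<bullet> y'"
    using Kc y r by (auto simp: scalar_prod_def intro!: sum.cong)
  then show "block (nu S) (K *\<^sub>v y) t $ i = block (nu S) (K *\<^sub>v y') t $ i"
    using i r Kc by (simp add: block_def)
qed simp

lemma cl_step_causal:
  assumes K: "K \<in> causal S"
    and eq: "\<And>s. s < k \<Longrightarrow> s < hor S \<Longrightarrow> block (nx S) x s = block (nx S) x' s"
    and t: "t \<le> k" "t < hor S"
  shows "block (nx S) (cl_step S K \<xi> x) t = block (nx S) (cl_step S K \<xi> x') t"
proof (cases t)
  case 0
  then show ?thesis using t block_cl_step_0 by simp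
next
  case (Suc r)
  have "block (nu S) (K *\<^sub>v cl_out S \<xi> x) r = block (nu S) (K *\<^sub>v cl_out S \<xi> x') r"
    by (rule causal_block_cong[OF K _ cl_out_carrier cl_out_carrier])
      (use Suc t eq in \<open>auto simp: block_cl_out\<close>)
  moreover have "block (nx S) x r = block (nx S) x' r" using eq Suc t by simp
  ultimately show ?thesis using Suc t by (simp add: block_cl_step_Suc)
qed

lemma closed_loop_iff_fixpoint:
  assumes K: "K \<in> causal S"
  shows "closed_loop S K \<xi> x u y \<longleftrightarrow>
    cl_step S K \<xi> x = x \<and> y = cl_out S \<xi> x \<and> u = K *\<^sub>v y" (is "?l \<longleftrightarrow> ?r")
proof
  assume l: ?l
  have y: "y = cl_out S \<xi> x"
    by (rule vec_eq_blocks[of _ "ny S" "hor S"])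
      (use l cl_out_carrier in \<open>auto simp: closed_loop_def block_cl_out\<close>)
  have "cl_step S K \<xi> x = x"
  proof (rule vec_eq_blocks[of _ "nx S" "hor S"])
    fix t assume "t < hor S"
    then show "block (nx S) (cl_step S K \<xi> x) t = block (nx S) x t"
      using l y by (cases t) (auto simp: closed_loop_def block_cl_step_0 block_cl_step_Suc)
  qed (use l cl_step_carrier in \<open>auto simp: closed_loop_def\<close>)
  then show ?r using l y by (simp add: closed_loop_def)
next
  assume r: ?r
  have Kc: "K \<in> carrier_mat (nu S * hor S) (ny S * hor S)" using K by (simp add: causal_def)
  have x: "x \<in> carrier_vec (nx S * hor S)" using r cl_step_carrier by metis
  have u: "u \<in> carrier_vec (nu S * hor S)"
    using r mult_mat_vec_carrier[OF Kc cl_out_carrier] by simp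
  have 0: "0 < hor S \<Longrightarrow> block (nx S) x 0 = block (nx S) (exo_w S \<xi>) 0"
    using r block_cl_step_0 by metis
  have 1: "block (nx S) x (t + 1) = matA S t *\<^sub>v block (nx S) x t
      + matB S t *\<^sub>v block (nu S) u t + block (nx S) (exo_w S \<xi>) (t + 1)"
    if "t + 1 < hor S" for t
    using block_cl_step_Suc[of t S K \<xi> x] that r by simp
  show ?l unfolding closed_loop_def
    using x u 0 1 r block_cl_out cl_out_carrier by blast
qed

theorem closed_loop_unique:
  assumes K: "K \<in> causal S"
  shows "\<exists>!(x, u, y). closed_loop S K \<xi> x u y"
proof -
  let ?F = "cl_step S K \<xi>"
  let ?z = "0\<^sub>v (nx S * hor S)"
  have agree: "block (nx S) ((?F ^^ k) x) t = block (nx S) ((?F ^^ k) x') t"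
    if "t < k" "t < hor S" for k t x x'
    using that
  proof (induction k arbitrary: t)
    case (Suc k)
    then show ?case using cl_step_causal[OF K, of k "(?F ^^ k) x" "(?F ^^ k) x'" t \<xi>] by simp
  qed simp
  define x where "x = ?F ((?F ^^ hor S) ?z)"
  have fx: "?F x = x"
  proof (rule vec_eq_blocks[of _ "nx S" "hor S", OF cl_step_carrier])
    show "x \<in> carrier_vec (nx S * hor S)" by (simp only: x_def cl_step_carrier)
    fix t assume "t < hor S"
    then show "block (nx S) (?F x) t = block (nx S) x t"
      using agree[of t "Suc (hor S)" "?F ?z" ?z]
      by (simp only: x_def funpow.simps comp_apply funpow_swap1[symmetric] less_SucI)
  qed
  have uniq: "x' = x" if "?F x' = x'" for x'
  proof -
    have it: "(?F ^^ k) a = a" if "?F a = a" for k a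
      by (induction k) (simp_all add: that)
    note it = it[OF fx] it[OF that]
    show ?thesis
    proof (rule vec_eq_blocks[of _ "nx S" "hor S"])
      show "x' \<in> carrier_vec (nx S * hor S)" using cl_step_carrier[of S K \<xi> x'] that by simp
      show "x \<in> carrier_vec (nx S * hor S)" using cl_step_carrier[of S K \<xi> x] fx by simp
      show "block (nx S) x' t = block (nx S) x t" if "t < hor S" for t
        using agree[of t "hor S" x' x] it that by simp
    qed
  qed
  show ?thesis
  proof (rule ex1I[of _ "(x, K *\<^sub>v cl_out S \<xi> x, cl_out S \<xi> x)"])
    show "case (x, K *\<^sub>v cl_out S \<xi> x, cl_out S \<xi> x) of
        (x, u, y) \<Rightarrow> closed_loop S K \<xi> x u y"
      using fx by (simp add: closed_loop_iff_fixpoint[OF K])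
    fix z assume z: "case z of (x, u, y) \<Rightarrow> closed_loop S K \<xi> x u y"
    obtain x' u y where zeq: "z = (x', u, y)" by (cases z)
    then have c: "?F x' = x'" "y = cl_out S \<xi> x'" "u = K *\<^sub>v y"
      using z by (simp_all add: closed_loop_iff_fixpoint[OF K])
    from uniq[OF c(1)] show "z = (x, K *\<^sub>v cl_out S \<xi> x, cl_out S \<xi> x)"
      using zeq c(2,3) by simp
  qed
qed

end

theory Submission
  imports Defs
begin

text \<open>The cost of a causal controller is a sum of squares of linear forms in the exogenous vector, so
  only second moments matter and no convergence of the empirical law in Wasserstein distance is needed.
  Adding independent noise with covariance \<open>(\<rho>\<^sup>2 / d) I\<close> to the empirical law moves it by at most
  \<open>\<rho>\<close>. Hence, as soon as the true covariance is at most the empirical one plus \<open>(\<rho>\<^sup>2 / d) I\<close>, the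
  worst case over the ball dominates the true cost of the robust controller. Conversely, along every
  linear form \<open>v\<close> the second moment of a law in the ball exceeds the empirical one by at most
  \<open>\<rho> (2 \<beta> + \<rho>) \<parallel>v\<parallel>\<^sup>2\<close>, and \<open>\<parallel>v\<parallel>\<^sup>2\<close> is at most \<open>\<alpha>\<^sup>2\<close> times the true second moment. It remains to
  show that the covariances are within \<open>\<rho>\<^sup>2 / d\<close> of each other with high probability: the entries
  concentrate at rate \<open>N\<^bsup>-1/2\<^esup>\<close> by Bernstein's inequality, while \<open>\<rho>\<^sup>2\<close> is of order \<open>N\<^bsup>-2/d\<^esup>\<close>, which is no smaller for
  \<open>d \<ge> 4\<close>.\<close>

subsection \<open>Extreme eigenvalues of real symmetric matrices\<close>

text \<open>The robust controller depends on the samples, so bounds for one fixed controller are of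
  no use: the covariance comparison has to hold on a single event for all linear forms at once. It
  is obtained from a union bound over the entries of the second-moment matrix and of the sample
  mean; the powers of d that this costs are absorbed into the constants. The condition \<gamma> > 2
  enters through r^2 \<le> 1 + r^\<gamma>: the exponential of the squared norm is integrable, hence
  products of two coordinates have exponential moments and Bernstein's inequality applies to them.
  The constants are fitted to the argument. With c1 = 2 * 5^d both logarithms in the radius become
  the same number L = ln (4 * 5^d / \<zeta>). The constant c2 is the rate for which the Bernstein
  exponent is exactly L, and c3 cancels \<open>K_const\<close> and makes the square of
  \<open>rho_mu\<close> a prescribed multiple of L / N. If N \<ge> L / c2, the summand
  \<open>rho_w\<close> alone is large enough; otherwise \<open>rho_mu\<close> alone is.\<close>

lemma scalar_prod_Cauchy_Schwarz:
  assumes "u \<in> carrier_vec n" "v \<in> carrier_vec n"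
  shows "(u \<bullet> v)\<^sup>2 \<le> (u \<bullet> u) * (v \<bullet> (v :: real vec))"
  using Cauchy_Schwarz_ineq_sum[of "\<lambda>i. u $ i" "\<lambda>i. v $ i" "{0..<n}"] assms
  by (simp add: scalar_prod_def power2_eq_square)

lemma mult_mat_vec_bounded:
  assumes M: "M \<in> carrier_mat n n"
  shows "\<exists>K>0. \<forall>v\<in>carrier_vec n. (M *\<^sub>v v) \<bullet> (M *\<^sub>v v) \<le> K * (v \<bullet> (v :: real vec))"
proof (intro exI conjI ballI)
  let ?K = "1 + (\<Sum>i<n. row M i \<bullet> row M i)"
  have nn: "0 \<le> row M i \<bullet> row M i" for i
    by (simp add: scalar_prod_def sum_nonneg)
  show "0 < ?K" using sum_nonneg[of "{..<n}" "\<lambda>i. row M i \<bullet> row M i"] nn by simp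
  fix v :: "real vec" assume v: "v \<in> carrier_vec n"
  have vv: "0 \<le> v \<bullet> v" by (simp add: scalar_prod_def sum_nonneg)
  have "(M *\<^sub>v v) \<bullet> (M *\<^sub>v v) = (\<Sum>i<n. (row M i \<bullet> v)\<^sup>2)"
    using M by (simp add: scalar_prod_def[of "M *\<^sub>v v"] power2_eq_square lessThan_atLeast0)
  also have "\<dots> \<le> (\<Sum>i<n. (row M i \<bullet> row M i) * (v \<bullet> v))"
    by (intro sum_mono scalar_prod_Cauchy_Schwarz[of _ n]) (use M v in auto)
  also have "\<dots> \<le> ?K * (v \<bullet> v)"
    using vv by (simp add: sum_distrib_right[symmetric] distrib_right)
  finally show "(M *\<^sub>v v) \<bullet> (M *\<^sub>v v) \<le> ?K * (v \<bullet> v)" .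
qed

text \<open>No compactness of the sphere is used. With w = B v, nonnegativity of the form at v - s
  w, for s the inverse of a bound M on the form, yields |B v|^2 \<le> M (v . B v). The inverse D of
  B then bounds |v|^2 by a multiple of |B v|^2.\<close>

lemma psd_det_nonzero_coercive:
  fixes B :: "real mat"
  assumes B: "B \<in> carrier_mat n n" and sym: "transpose_mat B = B"
    and psd: "\<And>v. v \<in> carrier_vec n \<Longrightarrow> 0 \<le> v \<bullet> (B *\<^sub>v v)"
    and det: "det B \<noteq> 0"
  shows "\<exists>c>0. \<forall>v\<in>carrier_vec n. c * (v \<bullet> v) \<le> v \<bullet> (B *\<^sub>v v)"
proof -
  obtain D where DB: "D * B = 1\<^sub>m n" and D: "D \<in> carrier_mat n n"
    using det_non_zero_imp_unit[OF B det, of "()"] unfolding Units_def ring_mat_def by auto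
  obtain K where K: "K > 0" "\<And>v. v \<in> carrier_vec n \<Longrightarrow> (B *\<^sub>v v) \<bullet> (B *\<^sub>v v) \<le> K * (v \<bullet> v)"
    using mult_mat_vec_bounded[OF B] by blast
  obtain L where L: "L > 0" "\<And>v. v \<in> carrier_vec n \<Longrightarrow> (D *\<^sub>v v) \<bullet> (D *\<^sub>v v) \<le> L * (v \<bullet> v)"
    using mult_mat_vec_bounded[OF D] by blast
  show ?thesis
  proof (intro exI conjI ballI)
    let ?M = "K + 1"
    show "0 < 1 / (L * ?M)" using K L by simp
    fix v :: "real vec" assume v: "v \<in> carrier_vec n"
    define w where "w = B *\<^sub>v v"
    have w: "w \<in> carrier_vec n" using B v by (simp add: w_def)
    have Bw: "B *\<^sub>v w \<in> carrier_vec n" using B w by simp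
    have ww: "0 \<le> w \<bullet> w" by (simp add: scalar_prod_def sum_nonneg)
    have BwBw: "(B *\<^sub>v w) \<bullet> (B *\<^sub>v w) \<le> K * (w \<bullet> w)" using K w by blast
    \<comment> \<open>Expanding |B w - w|^2 \<ge> 0 turns the bound \<open>K\<close> on |B w|^2 into
      a bound on the quadratic form.\<close>
    have wBw: "w \<bullet> (B *\<^sub>v w) \<le> ?M * (w \<bullet> w)"
    proof -
      have "0 \<le> (B *\<^sub>v w - w) \<bullet> (B *\<^sub>v w - w)" by (simp add: scalar_prod_def sum_nonneg)
      also have "\<dots> = (B *\<^sub>v w) \<bullet> (B *\<^sub>v w) - 2 * (w \<bullet> (B *\<^sub>v w)) + w \<bullet> w"
        using w Bw by (simp add: scalar_prod_minus_distrib[of _ n] minus_scalar_prod_distrib[of _ n]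
            comm_scalar_prod[of "B *\<^sub>v w" n w])
      finally have "2 * (w \<bullet> (B *\<^sub>v w)) \<le> K * (w \<bullet> w) + w \<bullet> w" using BwBw by linarith
      then show ?thesis using mult_nonneg_nonneg[OF less_imp_le[OF K(1)] ww] ww by (simp add: distrib_right)
    qed
    have vBw: "v \<bullet> (B *\<^sub>v w) = w \<bullet> w"
      using transpose_vec_mult_scalar[OF B w v] sym by (simp add: w_def)
    let ?s = "1 / ?M"
    have sw: "?s \<cdot>\<^sub>v w \<in> carrier_vec n" using w by simp
    have "0 \<le> (v - ?s \<cdot>\<^sub>v w) \<bullet> (B *\<^sub>v (v - ?s \<cdot>\<^sub>v w))" using psd v w by simp
    also have "B *\<^sub>v (v - ?s \<cdot>\<^sub>v w) = w - ?s \<cdot>\<^sub>v (B *\<^sub>v w)"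
      using mult_minus_distrib_mat_vec[OF B v sw] mult_mat_vec[OF B w, of ?s]
      by (simp add: w_def)
    also have "(v - ?s \<cdot>\<^sub>v w) \<bullet> (w - ?s \<cdot>\<^sub>v (B *\<^sub>v w))
        = v \<bullet> w - ?s * (w \<bullet> w) - ?s * (v \<bullet> (B *\<^sub>v w)) + ?s * ?s * (w \<bullet> (B *\<^sub>v w))"
      using v w Bw by (simp add: scalar_prod_minus_distrib[of _ n] minus_scalar_prod_distrib[of _ n])
    also have "\<dots> \<le> v \<bullet> w - ?s * (w \<bullet> w) - ?s * (w \<bullet> w) + ?s * ?s * (?M * (w \<bullet> w))"
      using wBw vBw K(1) by (intro add_mono diff_mono mult_left_mono) auto
    also have "\<dots> = v \<bullet> w - ?s * (w \<bullet> w)" using K(1) by simp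
    finally have 1: "w \<bullet> w \<le> ?M * (v \<bullet> w)" using K(1) by (simp add: field_simps)
    have "D *\<^sub>v w = v" using assoc_mult_mat_vec[OF D B v] DB v by (simp add: w_def)
    then have "v \<bullet> v \<le> L * (w \<bullet> w)" using L(2)[OF w] by simp
    also have "\<dots> \<le> L * (?M * (v \<bullet> w))" using 1 L(1) by (intro mult_left_mono) auto
    finally show "1 / (L * ?M) * (v \<bullet> v) \<le> v \<bullet> (B *\<^sub>v v)"
      using L(1) K(1) by (simp add: pos_divide_le_eq w_def mult_ac)
  qed
qed

text \<open>The eigenvalue is the least \<open>\<mu>\<close> with \<open>v\<^sup>T A v \<le> \<mu> v\<^sup>T v\<close> for all \<open>v\<close>: if \<open>\<mu> I - A\<close> were
  invertible it would be coercive, and \<open>\<mu>\<close> could be lowered.\<close>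

lemma symmetric_Rayleigh_eigenvalue:
  fixes A :: "real mat"
  assumes A: "A \<in> carrier_mat n n" and sym: "transpose_mat A = A" and n: "n > 0"
  shows "\<exists>e. eigenvalue A e \<and> (\<forall>v\<in>carrier_vec n. v \<bullet> (A *\<^sub>v v) \<le> e * (v \<bullet> v))"
proof -
  define C where "C = {\<mu>. \<forall>v\<in>carrier_vec n. v \<bullet> (A *\<^sub>v v) \<le> \<mu> * (v \<bullet> v)}"
  define e where "e = Inf C"
  obtain K where K: "K > 0" "\<And>v. v \<in> carrier_vec n \<Longrightarrow> (A *\<^sub>v v) \<bullet> (A *\<^sub>v v) \<le> K * (v \<bullet> v)"
    using mult_mat_vec_bounded[OF A] by blast
  have ne: "K + 1 \<in> C"
    unfolding C_def
  proof (intro CollectI ballI)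
    fix v :: "real vec" assume v: "v \<in> carrier_vec n"
    have Av: "A *\<^sub>v v \<in> carrier_vec n" using A v by simp
    have vv: "0 \<le> v \<bullet> v" by (simp add: scalar_prod_def sum_nonneg)
    have "0 \<le> (A *\<^sub>v v - v) \<bullet> (A *\<^sub>v v - v)" by (simp add: scalar_prod_def sum_nonneg)
    also have "\<dots> = (A *\<^sub>v v) \<bullet> (A *\<^sub>v v) - 2 * (v \<bullet> (A *\<^sub>v v)) + v \<bullet> v"
      using v Av by (simp add: scalar_prod_minus_distrib[of _ n] minus_scalar_prod_distrib[of _ n]
          comm_scalar_prod[of "A *\<^sub>v v" n v])
    finally have "2 * (v \<bullet> (A *\<^sub>v v)) \<le> K * (v \<bullet> v) + v \<bullet> v" using K(2)[OF v] by linarith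
    then show "v \<bullet> (A *\<^sub>v v) \<le> (K + 1) * (v \<bullet> v)"
      using mult_nonneg_nonneg[OF less_imp_le[OF K(1)] vv] vv by (simp add: distrib_right)
  qed
  \<comment> \<open>Any single Rayleigh quotient bounds \<open>C\<close> from below; the first unit
    vector exists because n > 0.\<close>
  have bdd: "bdd_below C"
  proof (rule bdd_belowI)
    fix \<mu> assume "\<mu> \<in> C"
    then show "unit_vec n 0 \<bullet> (A *\<^sub>v unit_vec n 0) \<le> \<mu>"
      using n unfolding C_def by (auto dest!: bspec[of _ _ "unit_vec n 0"])
  qed
  have eC: "v \<bullet> (A *\<^sub>v v) \<le> e * (v \<bullet> v)" if v: "v \<in> carrier_vec n" for v
  proof (cases "v \<bullet> v = 0")
    case True
    then show ?thesis using ne v unfolding C_def by force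
  next
    case False
    then have pos: "0 < v \<bullet> v" by (simp add: scalar_prod_def sum_nonneg order_less_le)
    have "v \<bullet> (A *\<^sub>v v) / (v \<bullet> v) \<le> e"
      unfolding e_def
    proof (rule cInf_greatest)
      show "C \<noteq> {}" using ne by blast
      show "v \<bullet> (A *\<^sub>v v) / (v \<bullet> v) \<le> \<mu>" if "\<mu> \<in> C" for \<mu>
        using that v pos by (simp add: C_def pos_divide_le_eq)
    qed
    then show ?thesis using pos by (simp add: field_simps)
  qed
  have "eigenvalue A e"
  proof (rule ccontr)
    \<comment> \<open>\<open>char_matrix A e\<close> is A - e I, so \<open>B\<close> is e I - A,
      whose form is nonnegative by \<open>eC\<close>.\<close>
    define B where "B = - char_matrix A e"
    assume "\<not> eigenvalue A e"
    then have "det (char_matrix A e) \<noteq> 0" using eigenvalue_det[OF A] by simp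
    moreover have cA: "char_matrix A e \<in> carrier_mat n n" using A by simp
    have Bs: "B = (-1) \<cdot>\<^sub>m char_matrix A e" unfolding B_def by auto
    ultimately have dB: "det B \<noteq> 0"
      unfolding Bs using det_smult[of "-1" "char_matrix A e"] by simp
    have B: "B \<in> carrier_mat n n" using cA by (simp add: B_def)
    have "transpose_mat B = B"
    proof (rule eq_matI)
      fix i j assume ij: "i < dim_row B" "j < dim_col B"
      then have "A $$ (j, i) = A $$ (i, j)" using A sym B by (metis carrier_matD index_transpose_mat(1))
      then show "transpose_mat B $$ (i, j) = B $$ (i, j)"
        using ij A B by (auto simp: B_def char_matrix_def)
    qed (use B in auto)
    moreover have qB: "v \<bullet> (B *\<^sub>v v) = e * (v \<bullet> v) - v \<bullet> (A *\<^sub>v v)"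
      if v: "v \<in> carrier_vec n" for v
    proof -
      have "char_matrix A e *\<^sub>v v = A *\<^sub>v v + (-e) \<cdot>\<^sub>v v"
        unfolding char_matrix_def using A v
        by (subst add_mult_distrib_mat_vec[of _ n n]) auto
      moreover have "B *\<^sub>v v = (-1) \<cdot>\<^sub>v (char_matrix A e *\<^sub>v v)"
        unfolding Bs using cA v by (intro eq_vecI) auto
      ultimately show ?thesis using A v
        by (simp add: scalar_prod_add_distrib[of _ n])
    qed
    ultimately obtain c where c: "c > 0" "\<And>v. v \<in> carrier_vec n \<Longrightarrow> c * (v \<bullet> v) \<le> v \<bullet> (B *\<^sub>v v)"
      using psd_det_nonzero_coercive[OF B _ _ dB] eC by fastforce
    have "e - c \<in> C" unfolding C_def using c(2) qB by (force simp: algebra_simps)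
    then have "e \<le> e - c" unfolding e_def using bdd cInf_lower by metis
    then show False using c(1) by simp
  qed
  then show ?thesis using eC by blast
qed

text \<open>\<open>Max\<close> says nothing about an empty set, so the eigenvalue just constructed
  serves twice: it makes the spectrum nonempty, and it is a lower bound for the maximum that already
  dominates every Rayleigh quotient.\<close>

lemma Rayleigh_le_lambda_max:
  assumes A: "A \<in> carrier_mat n n" and sym: "transpose_mat A = A" and n: "n > 0"
  shows "lambda_max A \<in> spectrum A"
    and "v \<in> carrier_vec n \<Longrightarrow> v \<bullet> (A *\<^sub>v v) \<le> lambda_max A * (v \<bullet> v)"
proof -
  obtain e where e: "eigenvalue A e" "\<forall>v\<in>carrier_vec n. v \<bullet> (A *\<^sub>v v) \<le> e * (v \<bullet> v)"
    using symmetric_Rayleigh_eigenvalue[OF assms] by blast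
  have es: "e \<in> spectrum A" using e(1) by (simp add: spectrum_def)
  show "lambda_max A \<in> spectrum A"
    unfolding lambda_max_def using card_finite_spectrum[OF A] es by (intro Max_in) auto
  have le: "e \<le> lambda_max A"
    unfolding lambda_max_def using card_finite_spectrum[OF A] es by simp
  assume "v \<in> carrier_vec n"
  then have "v \<bullet> (A *\<^sub>v v) \<le> e * (v \<bullet> v)" using e(2) by blast
  also have "\<dots> \<le> lambda_max A * (v \<bullet> v)"
    using le by (intro mult_right_mono) (simp_all add: scalar_prod_def sum_nonneg)
  finally show "v \<bullet> (A *\<^sub>v v) \<le> lambda_max A * (v \<bullet> v)" .
qed

text \<open>The upper bound is applied to -A; the eigenvalue e found there gives the eigenvalue -e
  of A below all Rayleigh quotients.\<close>

lemma lambda_min_le_Rayleigh: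
  assumes A: "A \<in> carrier_mat n n" and sym: "transpose_mat A = A" and n: "n > 0"
  shows "lambda_min A \<in> spectrum A"
    and "v \<in> carrier_vec n \<Longrightarrow> lambda_min A * (v \<bullet> v) \<le> v \<bullet> (A *\<^sub>v v)"
proof -
  have mA: "- A \<in> carrier_mat n n" using A by simp
  have "transpose_mat (- A) = - A"
    using sym A by (intro eq_matI) (auto, metis carrier_matD index_transpose_mat(1))
  then obtain e where e: "eigenvalue (- A) e"
      "\<forall>v\<in>carrier_vec n. v \<bullet> (- A *\<^sub>v v) \<le> e * (v \<bullet> v)"
    using symmetric_Rayleigh_eigenvalue[OF mA _ n] by blast
  have neg: "- A *\<^sub>v v = - (A *\<^sub>v v)" if "v \<in> carrier_vec n" for v
    using A that by (intro eq_vecI) auto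
  obtain w where w: "w \<in> carrier_vec n" "w \<noteq> 0\<^sub>v n" "- (A *\<^sub>v w) = e \<cdot>\<^sub>v w"
    using e(1) A neg unfolding eigenvalue_def eigenvector_def by auto
  have "A *\<^sub>v w = - (e \<cdot>\<^sub>v w)" using w(3) by (metis uminus_uminus_vec)
  also have "\<dots> = (- e) \<cdot>\<^sub>v w" by auto
  finally have "eigenvalue A (- e)"
    using w A unfolding eigenvalue_def eigenvector_def by auto
  then have es: "- e \<in> spectrum A" by (simp add: spectrum_def)
  show "lambda_min A \<in> spectrum A"
    unfolding lambda_min_def using card_finite_spectrum[OF A] es by (intro Min_in) auto
  have le: "lambda_min A \<le> - e"
    unfolding lambda_min_def using card_finite_spectrum[OF A] es by simp
  assume v: "v \<in> carrier_vec n"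
  have "lambda_min A * (v \<bullet> v) \<le> - e * (v \<bullet> v)"
    using le by (intro mult_right_mono) (simp_all add: scalar_prod_def sum_nonneg)
  also have "\<dots> \<le> v \<bullet> (A *\<^sub>v v)"
    using e(2)[rule_format, OF v] neg[OF v] A v by simp
  finally show "lambda_min A * (v \<bullet> v) \<le> v \<bullet> (A *\<^sub>v v)" .
qed

text \<open>Transfers the sign of the quadratic form to the extreme eigenvalues. These signs are
  needed later, since \<open>powr\<close> acts as a square root only on nonnegative bases.\<close>

lemma spectrum_Rayleigh:
  assumes "A \<in> carrier_mat n n" "e \<in> spectrum A"
  shows "\<exists>v\<in>carrier_vec n. v \<noteq> 0\<^sub>v n \<and> 0 < v \<bullet> v \<and> v \<bullet> (A *\<^sub>v v) = (e :: real) * (v \<bullet> v)"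
proof -
  obtain v where v: "v \<in> carrier_vec n" "v \<noteq> 0\<^sub>v n" "A *\<^sub>v v = e \<cdot>\<^sub>v v"
    using assms unfolding spectrum_def eigenvalue_def eigenvector_def by auto
  have "v \<bullet> v \<noteq> 0" using v conjugate_square_eq_0_vec[OF v(1)] by simp
  then have "0 < v \<bullet> v" by (simp add: scalar_prod_def sum_nonneg order_less_le)
  then show ?thesis using v by (intro bexI[of _ v]) auto
qed

subsection \<open>The closed-loop cost as a sum of squares\<close>

text \<open>Completing the square in the last variable, by induction on the dimension. A nonzero
  pivot is positive and leaves its Schur complement, which is again nonnegative; a zero pivot forces
  the whole last column to vanish.\<close>

lemma psd_form_sum_squares:
  fixes a :: "nat \<Rightarrow> nat \<Rightarrow> real"
  assumes "\<And>i j. i < n \<Longrightarrow> j < n \<Longrightarrow> a i j = a j i"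
    and "\<And>v. 0 \<le> (\<Sum>i<n. \<Sum>j<n. a i j * v i * v j)"
  shows "\<exists>l (m::nat). \<forall>v. (\<Sum>i<n. \<Sum>j<n. a i j * v i * v j) = (\<Sum>k<m. (\<Sum>i<n. l k i * v i)\<^sup>2)"
  using assms
proof (induction n arbitrary: a)
  case 0
  show ?case by (auto intro!: exI[of _ 0])
next
  case (Suc n)
  let ?q = "\<lambda>n a v. \<Sum>i<n. \<Sum>j<n. a i j * v i * (v j :: real)"
  let ?r = "\<lambda>v. \<Sum>i<n. a i n * v i"
  have split: "?q (Suc n) a v = ?q n a v + 2 * v n * ?r v + a n n * (v n)\<^sup>2" for v
  proof -
    have "(\<Sum>j<n. a n j * v n * v j) = v n * ?r v"
      unfolding sum_distrib_left by (intro sum.cong) (use Suc.prems(1) in auto)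
    moreover have "(\<Sum>i<n. a i n * v i * v n) = v n * ?r v"
      unfolding sum_distrib_left by (intro sum.cong) auto
    ultimately show ?thesis by (simp add: sum.distrib power2_eq_square)
  qed
  show ?case
  proof (cases "a n n = 0")
    case True
    have z: "a i n = 0" if i: "i < n" for i
    proof (rule ccontr)
      assume nz: "a i n \<noteq> 0"
      let ?w = "\<lambda>t k. if k = n then t else if k = i then 1 else (0::real)"
      have "?r (?w t) = a i n" for t
        using i by (simp add: if_distrib[of "\<lambda>x. _ * x"] sum.delta' cong: if_cong)
      moreover have "?q n a (?w t) = ?q n a (?w 0)" for t by (intro sum.cong) auto
      ultimately have nn: "0 \<le> ?q n a (?w 0) + 2 * t * a i n" for t
        using Suc.prems(2)[of "?w t"] unfolding split True by simp
      define c where "c = ?q n a (?w 0)"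
      \<comment> \<open>Along \<open>?w t\<close> the form is affine in t with slope 2 *
        \<open>a i n\<close>; this value of t makes it equal to -1, contradicting
        nonnegativity.\<close>
      have "2 * (- (c + 1) / (2 * a i n)) * a i n = - (c + 1)" using nz by simp
      then show False using nn[of "- (c + 1) / (2 * a i n)"] unfolding c_def[symmetric] by linarith
    qed
    then have eq: "?q (Suc n) a v = ?q n a v" for v unfolding split True by simp
    have "\<exists>l (m::nat). \<forall>v. ?q n a v = (\<Sum>k<m. (\<Sum>i<n. l k i * v i)\<^sup>2)"
    proof (rule Suc.IH)
      show "a i j = a j i" if "i < n" "j < n" for i j using that Suc.prems(1) by simp
      show "0 \<le> ?q n a v" for v using Suc.prems(2)[of v] unfolding eq .
    qed
    then obtain l and m :: nat where lm: "\<And>v. ?q n a v = (\<Sum>k<m. (\<Sum>i<n. l k i * v i)\<^sup>2)"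
      by blast
    show ?thesis
      unfolding eq lm
      by (rule exI[of _ "\<lambda>k i. if i < n then l k i else 0"], rule exI[of _ m]) simp
  next
    case False
    define d where "d = a n n"
    \<comment> \<open>The Schur complement of the pivot \<open>d\<close>.\<close>
    define b where "b i j = a i j - a i n * a j n / d" for i j
    have rr: "(?r v)\<^sup>2 = (\<Sum>i<n. \<Sum>j<n. a i n * a j n * v i * v j)" for v
      by (simp add: power2_eq_square sum_product mult_ac)
    have qb: "?q n b v = ?q n a v - (?r v)\<^sup>2 / d" for v
      unfolding rr b_def by (simp add: sum_subtractf sum_divide_distrib left_diff_distrib)
    have "0 \<le> ?q (Suc n) a (\<lambda>k. if k = n then 1 else 0)" by (rule Suc.prems(2))
    then have d: "d > 0" using False unfolding split d_def by simp
    have sq: "?q (Suc n) a v = ?q n b v + (sqrt d * v n + ?r v / sqrt d)\<^sup>2" for v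
      unfolding split qb using d
      by (simp add: power2_sum power_mult_distrib power_divide d_def[symmetric])
    have "0 \<le> ?q n b v" for v
    proof -
      \<comment> \<open>The last coordinate is chosen to minimise the form: the completed square
        vanishes and only the form of \<open>b\<close> remains.\<close>
      let ?v = "v(n := - ?r v / d)"
      have "?r ?v = ?r v" "?q n b ?v = ?q n b v" by (auto intro!: sum.cong)
      moreover have "sqrt d * (- ?r v / d) + ?r v / sqrt d = 0"
        using d by (simp add: field_simps)
      ultimately show ?thesis using Suc.prems(2)[of ?v] unfolding sq by simp
    qed
    moreover have "b i j = b j i" if "i < n" "j < n" for i j
      using that Suc.prems(1)[of i j] by (simp add: b_def)
    ultimately have "\<exists>l (m::nat). \<forall>v. ?q n b v = (\<Sum>k<m. (\<Sum>i<n. l k i * v i)\<^sup>2)"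
      by (intro Suc.IH)
    then obtain l and m :: nat where lm: "\<And>v. ?q n b v = (\<Sum>k<m. (\<Sum>i<n. l k i * v i)\<^sup>2)"
      by blast
    let ?l = "\<lambda>k i. if k < m then if i < n then l k i else 0
      else if i < n then a i n / sqrt d else sqrt d"
    have "(\<Sum>i<Suc n. ?l m i * v i) = sqrt d * v n + ?r v / sqrt d" for v
      by (simp add: sum_divide_distrib)
    then show ?thesis
      unfolding sq lm by (intro exI[of _ ?l] exI[of _ "Suc m"]) (simp add: add.commute)
  qed
qed

lemma psd_mat_sum_squares:
  assumes "psd_mat n A"
  shows "\<exists>l (m::nat). \<forall>x\<in>carrier_vec n. x \<bullet> (A *\<^sub>v x) = (\<Sum>k<m. (\<Sum>i<n. l k i * x $ i)\<^sup>2)"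
proof -
  have A: "A \<in> carrier_mat n n" "transpose_mat A = A"
      "\<And>v. v \<in> carrier_vec n \<Longrightarrow> 0 \<le> v \<bullet> (A *\<^sub>v v)"
    using assms by (auto simp: psd_mat_def)
  have q: "x \<bullet> (A *\<^sub>v x) = (\<Sum>i<n. \<Sum>j<n. A $$ (i, j) * x $ i * x $ j)"
    if "x \<in> carrier_vec n" for x
    using A(1) that by (auto simp: scalar_prod_def lessThan_atLeast0 sum_distrib_left mult_ac
        intro!: sum.cong)
  have "\<exists>l (m::nat). \<forall>v. (\<Sum>i<n. \<Sum>j<n. A $$ (i, j) * v i * v j) = (\<Sum>k<m. (\<Sum>i<n. l k i * v i)\<^sup>2)"
  proof (rule psd_form_sum_squares)
    show "A $$ (i, j) = A $$ (j, i)" if "i < n" "j < n" for i j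
      using A(1,2) that by (metis carrier_matD index_transpose_mat(1))
    show "0 \<le> (\<Sum>i<n. \<Sum>j<n. A $$ (i, j) * v i * v j)" for v
      using A(3)[of "vec n v"] q[of "vec n v"] by simp
  qed
  then obtain l m where lm:
      "\<And>v. (\<Sum>i<n. \<Sum>j<n. A $$ (i, j) * v i * v j) = (\<Sum>k<m::nat. (\<Sum>i<n. l k i * v i)\<^sup>2)"
    by blast
  show ?thesis by (intro exI[of _ l] exI[of _ m]) (simp add: q lm)
qed

lemma pd_imp_psd_mat:
  assumes "pd_mat n A"
  shows "psd_mat n A"
  unfolding psd_mat_def
proof (intro conjI ballI)
  show A: "A \<in> carrier_mat n n" and "transpose_mat A = A" using assms by (auto simp: pd_mat_def)
  show "0 \<le> v \<bullet> (A *\<^sub>v v)" if "v \<in> carrier_vec n" for v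
    using assms that A by (cases "v = 0\<^sub>v n") (auto simp: pd_mat_def intro: less_imp_le)
qed

section \<open>Linear dependence of the closed loop on the exogenous vector\<close>

lemma block_add:
  assumes "x \<in> carrier_vec (k * T)" "y \<in> carrier_vec (k * T)" "t < T"
  shows "block k (x + y) t = block k x t + block k y t"
  using assms by (intro eq_vecI) (auto simp: block_def idx_bound)

lemma block_smult:
  assumes "x \<in> carrier_vec (k * T)" "t < T"
  shows "block k (c \<cdot>\<^sub>v x) t = c \<cdot>\<^sub>v block k x t"
  using assms by (intro eq_vecI) (auto simp: block_def idx_bound)

text \<open>The scalar makes additivity and homogeneity one statement. Below, c = -1 produces the
  zero trajectory and c = \<open>\<xi> m\<close> adds one coordinate of the noise.\<close>

lemma closed_loop_add:
  assumes S: "lq_problem S" and K: "K \<in> causal S"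
    and 1: "closed_loop S K \<xi> x u y" and 2: "closed_loop S K \<xi>' x' u' y'"
  shows "closed_loop S K (\<lambda>i. \<xi> i + c * \<xi>' i) (x + c \<cdot>\<^sub>v x') (u + c \<cdot>\<^sub>v u') (y + c \<cdot>\<^sub>v y')"
proof -
  note c = 1[unfolded closed_loop_def] 2[unfolded closed_loop_def]
  have K': "K \<in> carrier_mat (nu S * hor S) (ny S * hor S)" using K by (simp add: causal_def)
  have car: "x \<in> carrier_vec (nx S * hor S)" "u \<in> carrier_vec (nu S * hor S)"
    "y \<in> carrier_vec (ny S * hor S)" "x' \<in> carrier_vec (nx S * hor S)"
    "u' \<in> carrier_vec (nu S * hor S)" "y' \<in> carrier_vec (ny S * hor S)" using c by auto
  have w: "exo_w S (\<lambda>i. \<xi> i + c * \<xi>' i) = exo_w S \<xi> + c \<cdot>\<^sub>v exo_w S \<xi>'"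
    by (auto simp: exo_w_def)
  have v: "exo_v S (\<lambda>i. \<xi> i + c * \<xi>' i) = exo_v S \<xi> + c \<cdot>\<^sub>v exo_v S \<xi>'"
    by (auto simp: exo_v_def)
  have wc: "exo_w S z \<in> carrier_vec (nx S * hor S)" "exo_v S z \<in> carrier_vec (ny S * hor S)" for z
    by (auto simp: exo_w_def exo_v_def)
  have comb: "block k (a + c \<cdot>\<^sub>v b) t = block k a t + c \<cdot>\<^sub>v block k b t"
    if "a \<in> carrier_vec (k * hor S)" "b \<in> carrier_vec (k * hor S)" "t < hor S" for k a b t
    using that by (simp add: block_add[of _ k "hor S"] block_smult[of _ k "hor S"])
  have lin: "M *\<^sub>v (a + c \<cdot>\<^sub>v b) = M *\<^sub>v a + c \<cdot>\<^sub>v (M *\<^sub>v b)"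
    if "M \<in> carrier_mat p q" "a \<in> carrier_vec q" "b \<in> carrier_vec q" for M p q and a b :: "real vec"
    using that by (simp add: mult_add_distrib_mat_vec[of _ p q] mult_mat_vec[of _ p q])
  have assoc4: "(a + c \<cdot>\<^sub>v a') + (b + c \<cdot>\<^sub>v b') = (a + b) + c \<cdot>\<^sub>v (a' + b')"
    if "a \<in> carrier_vec q" "a' \<in> carrier_vec q" "b \<in> carrier_vec q" "b' \<in> carrier_vec q"
    for a a' b b' :: "real vec" and q
    using that by (intro eq_vecI) (auto simp: algebra_simps)
  have M: "matA S t \<in> carrier_mat (nx S) (nx S)" "matB S t \<in> carrier_mat (nx S) (nu S)"
     "matC S t \<in> carrier_mat (ny S) (nx S)" if "t < hor S" for t
    using S that by (auto simp: lq_problem_def)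
  have Mb: "matA S t *\<^sub>v block (nx S) z s \<in> carrier_vec (nx S)"
    "matB S t *\<^sub>v block (nu S) z s \<in> carrier_vec (nx S)"
    "matC S t *\<^sub>v block (nx S) z s \<in> carrier_vec (ny S)" if "t < hor S" for t s z
    using M[OF that] by auto
  show ?thesis
    unfolding closed_loop_def
  proof (intro conjI allI impI)
    show "block (nx S) (x + c \<cdot>\<^sub>v x') 0 = block (nx S) (exo_w S (\<lambda>i. \<xi> i + c * \<xi>' i)) 0"
      if "0 < hor S"
      using c car wc that by (simp add: w comb)
    fix t
    show "block (nx S) (x + c \<cdot>\<^sub>v x') (t + 1) =
          matA S t *\<^sub>v block (nx S) (x + c \<cdot>\<^sub>v x') t + matB S t *\<^sub>v block (nu S) (u + c \<cdot>\<^sub>v u') t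
            + block (nx S) (exo_w S (\<lambda>i. \<xi> i + c * \<xi>' i)) (t + 1)" if t: "t + 1 < hor S"
    proof -
      have t': "t < hor S" using t by simp
      have "block (nx S) (x + c \<cdot>\<^sub>v x') (t + 1) = block (nx S) x (t + 1) + c \<cdot>\<^sub>v block (nx S) x' (t + 1)"
        using car t by (simp add: comb)
      also have "\<dots> = matA S t *\<^sub>v block (nx S) x t + matB S t *\<^sub>v block (nu S) u t
            + block (nx S) (exo_w S \<xi>) (t + 1) + c \<cdot>\<^sub>v (matA S t *\<^sub>v block (nx S) x' t
            + matB S t *\<^sub>v block (nu S) u' t + block (nx S) (exo_w S \<xi>') (t + 1))"
        using c t by metis
      finally show ?thesis
        unfolding w comb[OF wc(1) wc(1) t] comb[OF car(1,4) t'] comb[OF car(2,5) t']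
          lin[OF M(1)[OF t'] block_dim(2) block_dim(2)] lin[OF M(2)[OF t'] block_dim(2) block_dim(2)]
        using Mb[OF t'] by (simp add: assoc4[where q = "nx S"])
    qed
    show "block (ny S) (y + c \<cdot>\<^sub>v y') t = matC S t *\<^sub>v block (nx S) (x + c \<cdot>\<^sub>v x') t
        + block (ny S) (exo_v S (\<lambda>i. \<xi> i + c * \<xi>' i)) t" if t: "t < hor S"
    proof -
      have "block (ny S) (y + c \<cdot>\<^sub>v y') t = block (ny S) y t + c \<cdot>\<^sub>v block (ny S) y' t"
        using car t by (simp add: comb)
      also have "\<dots> = matC S t *\<^sub>v block (nx S) x t + block (ny S) (exo_v S \<xi>) t
          + c \<cdot>\<^sub>v (matC S t *\<^sub>v block (nx S) x' t + block (ny S) (exo_v S \<xi>') t)"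
        using c t by metis
      finally show ?thesis
        unfolding v comb[OF wc(2) wc(2) t] comb[OF car(1,4) t]
          lin[OF M(3)[OF t] block_dim(2) block_dim(2)]
        using Mb[OF t] by (simp add: assoc4[where q = "ny S"])
    qed
    show "u + c \<cdot>\<^sub>v u' = K *\<^sub>v (y + c \<cdot>\<^sub>v y')"
      using c lin[OF K' car(3,6)] by simp
  qed (use car in auto)
qed

lemma closed_loop_trajectory:
  assumes "K \<in> causal S"
  shows "closed_loop S K \<xi> x u y \<longleftrightarrow> trajectory S K \<xi> = (x, u, y)"
proof -
  have "\<exists>!z. (\<lambda>(x, u, y). closed_loop S K \<xi> x u y) z"
    using closed_loop_unique[OF assms] by simp
  from theI'[OF this] this show ?thesis
    unfolding trajectory_def by (auto intro: the_equality)
qed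

text \<open>Exogenous vectors are functions on all naturals; this allows replacing them by their
  truncations, which are finite combinations of unit impulses.\<close>

lemma closed_loop_cong:
  assumes "\<And>i. i < noise_dim S \<Longrightarrow> \<xi> i = \<xi>' i"
  shows "closed_loop S K \<xi> = closed_loop S K \<xi>'"
proof -
  have "exo_w S \<xi> = exo_w S \<xi>'" "exo_v S \<xi> = exo_v S \<xi>'"
    using assms by (auto simp: exo_w_def exo_v_def noise_dim_def algebra_simps)
  then show ?thesis by (intro ext) (simp add: closed_loop_def)
qed

text \<open>The columns of \<open>X\<close> and \<open>U\<close> are the responses to the unit
  impulses. Uniqueness of the closed loop identifies the trajectory of a truncation with the
  superposition of these responses, one coordinate at a time.\<close>

lemma closed_loop_superposition:
  assumes S: "lq_problem S" and K: "K \<in> causal S"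
  shows "\<exists>X U. \<forall>\<xi> x u y. closed_loop S K \<xi> x u y \<longrightarrow>
    (\<forall>j < nx S * hor S. x $ j = (\<Sum>i<noise_dim S. X j i * \<xi> i)) \<and>
    (\<forall>j < nu S * hor S. u $ j = (\<Sum>i<noise_dim S. U j i * \<xi> i))"
proof -
  define e :: "nat \<Rightarrow> nat \<Rightarrow> real" where "e i = (\<lambda>k. if k = i then 1 else 0)" for i
  define X where "X j i = fst (trajectory S K (e i)) $ j" for j i
  define U where "U j i = fst (snd (trajectory S K (e i))) $ j" for j i
  have ex: "\<exists>x u y. closed_loop S K \<xi> x u y" for \<xi>
    using closed_loop_unique[OF K, of \<xi>] by (auto simp: Ex1_def)
  have uniq: "x = x' \<and> u = u' \<and> y = y'"
    if "closed_loop S K \<xi> x u y" "closed_loop S K \<xi> x' u' y'" for \<xi> x u y x' u' y'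
    using that unfolding closed_loop_trajectory[OF K] by simp
  have zero: "closed_loop S K (\<lambda>i. 0) (0\<^sub>v (nx S * hor S)) (0\<^sub>v (nu S * hor S)) (0\<^sub>v (ny S * hor S))"
  proof -
    obtain x u y where c: "closed_loop S K (\<lambda>i. 0) x u y" using ex by blast
    have car: "x \<in> carrier_vec (nx S * hor S)" "u \<in> carrier_vec (nu S * hor S)"
      "y \<in> carrier_vec (ny S * hor S)" using c by (auto simp: closed_loop_def)
    have "x + (-1) \<cdot>\<^sub>v x = 0\<^sub>v (nx S * hor S)" "u + (-1) \<cdot>\<^sub>v u = 0\<^sub>v (nu S * hor S)"
      "y + (-1) \<cdot>\<^sub>v y = 0\<^sub>v (ny S * hor S)"
      using car by auto
    then show ?thesis using closed_loop_add[OF S K c c, of "-1"] by simp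
  qed
  have main: "closed_loop S K (\<lambda>k. if k < m then \<xi> k else 0) x u y \<Longrightarrow>
    (\<forall>j < nx S * hor S. x $ j = (\<Sum>i<m. X j i * \<xi> i)) \<and>
    (\<forall>j < nu S * hor S. u $ j = (\<Sum>i<m. U j i * \<xi> i))" for m \<xi> x u y
  proof (induction m arbitrary: x u y)
    case 0
    then have "closed_loop S K (\<lambda>k. 0) x u y" by simp
    from uniq[OF this zero] show ?case by simp
  next
    case (Suc m)
    obtain x1 u1 y1 where c1: "closed_loop S K (\<lambda>k. if k < m then \<xi> k else 0) x1 u1 y1"
      using ex by blast
    obtain x2 u2 y2 where c2: "closed_loop S K (e m) x2 u2 y2" using ex by blast
    have car: "x2 \<in> carrier_vec (nx S * hor S)" "u2 \<in> carrier_vec (nu S * hor S)"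
      "x1 \<in> carrier_vec (nx S * hor S)" "u1 \<in> carrier_vec (nu S * hor S)"
      using c1 c2 by (auto simp: closed_loop_def)
    have XU: "X j m = x2 $ j" "U j m = u2 $ j" for j
      using c2 unfolding closed_loop_trajectory[OF K] by (simp_all add: X_def U_def)
    have "(\<lambda>k. if k < Suc m then \<xi> k else 0) = (\<lambda>k. (if k < m then \<xi> k else 0) + \<xi> m * e m k)"
      by (auto simp: e_def less_Suc_eq)
    then have "x = x1 + \<xi> m \<cdot>\<^sub>v x2" "u = u1 + \<xi> m \<cdot>\<^sub>v u2"
      using uniq[OF Suc.prems] closed_loop_add[OF S K c1 c2, of "\<xi> m"] by metis+
    then show ?case using Suc.IH[OF c1] car XU by simp
  qed
  show ?thesis
  proof (rule exI[of _ X], rule exI[of _ U], intro allI impI)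
    fix \<xi> x u y assume "closed_loop S K \<xi> x u y"
    moreover have "closed_loop S K \<xi> = closed_loop S K (\<lambda>k. if k < noise_dim S then \<xi> k else 0)"
      by (rule closed_loop_cong) simp
    ultimately show "(\<forall>j < nx S * hor S. x $ j = (\<Sum>i<noise_dim S. X j i * \<xi> i)) \<and>
      (\<forall>j < nu S * hor S. u $ j = (\<Sum>i<noise_dim S. U j i * \<xi> i))" using main by simp
  qed
qed

text \<open>The finite family of linear forms depends on the controller but not on the noise. An
  inequality between second moments that holds for every linear form therefore passes to the cost of
  every causal controller.\<close>

lemma lq_cost_sum_squares:
  assumes S: "lq_problem S" and K: "K \<in> causal S"
  shows "\<exists>l (m::nat). \<forall>\<xi>. lq_cost S K \<xi> = (\<Sum>a<m. (\<Sum>i<noise_dim S. l a i * \<xi> i)\<^sup>2)"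
proof -
  let ?nx = "nx S * hor S" and ?nu = "nu S * hor S" and ?d = "noise_dim S"
  obtain X U where XU: "\<And>\<xi> x u y. closed_loop S K \<xi> x u y \<Longrightarrow>
    (\<forall>j < ?nx. x $ j = (\<Sum>i<?d. X j i * \<xi> i)) \<and> (\<forall>j < ?nu. u $ j = (\<Sum>i<?d. U j i * \<xi> i))"
    using closed_loop_superposition[OF assms] by blast
  have Q: "psd_mat ?nx (matQ S)" and R: "psd_mat ?nu (matR S)"
    using S pd_imp_psd_mat by (auto simp: lq_problem_def)
  obtain q and mq :: nat where q: "\<And>x. x \<in> carrier_vec ?nx \<Longrightarrow>
      x \<bullet> (matQ S *\<^sub>v x) = (\<Sum>k<mq. (\<Sum>i<?nx. q k i * x $ i)\<^sup>2)"
    using psd_mat_sum_squares[OF Q] by blast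
  obtain r and mr :: nat where r: "\<And>x. x \<in> carrier_vec ?nu \<Longrightarrow>
      x \<bullet> (matR S *\<^sub>v x) = (\<Sum>k<mr. (\<Sum>i<?nu. r k i * x $ i)\<^sup>2)"
    using psd_mat_sum_squares[OF R] by blast
  \<comment> \<open>The squares coming from the state cost are numbered first, those from the input
    cost start at \<open>mq\<close>.\<close>
  define l where "l a i = (if a < mq then \<Sum>j<?nx. q a j * X j i
      else \<Sum>j<?nu. r (a - mq) j * U j i)" for a i
  have swap: "(\<Sum>j<n. p j * (\<Sum>i<?d. Z j i * \<xi> i)) = (\<Sum>i<?d. (\<Sum>j<n. p j * Z j i) * \<xi> i)"
    for p :: "nat \<Rightarrow> real" and Z \<xi> and n :: nat
    unfolding sum_distrib_left sum_distrib_right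
    by (subst sum.swap) (simp add: mult_ac)
  have "lq_cost S K \<xi> = (\<Sum>a<mq + mr. (\<Sum>i<?d. l a i * \<xi> i)\<^sup>2)" for \<xi>
  proof -
    obtain x u y where t: "trajectory S K \<xi> = (x, u, y)" by (cases "trajectory S K \<xi>")
    then have c: "closed_loop S K \<xi> x u y" using closed_loop_trajectory[OF K] by simp
    then have car: "x \<in> carrier_vec ?nx" "u \<in> carrier_vec ?nu" by (auto simp: closed_loop_def)
    have 1: "(\<Sum>j<?nx. q a j * x $ j) = (\<Sum>i<?d. l a i * \<xi> i)" if "a < mq" for a
      using XU[OF c] that by (simp add: l_def swap)
    have 2: "(\<Sum>j<?nu. r a j * u $ j) = (\<Sum>i<?d. l (mq + a) i * \<xi> i)" for a
      using XU[OF c] by (simp add: l_def swap)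
    have add: "sum g {..<mq + mr} = sum g {..<mq} + (\<Sum>k<mr. g (mq + k))" for g :: "nat \<Rightarrow> real"
      by (induction mr) (simp_all add: add.assoc)
    show ?thesis unfolding lq_cost_def t using car 1 2 by (simp add: q r add)
  qed
  then show ?thesis by blast
qed

subsection \<open>Second moments and the Wasserstein ball\<close>

text \<open>Vectors of \<open>\<real>\<^sup>d\<close> are functions of which only the values on \<open>{..<d}\<close> matter.\<close>

definition lin :: "nat \<Rightarrow> (nat \<Rightarrow> real) \<Rightarrow> (nat \<Rightarrow> real) \<Rightarrow> real" where
  "lin d v \<xi> = (\<Sum>i<d. v i * \<xi> i)"

definition sqn :: "nat \<Rightarrow> (nat \<Rightarrow> real) \<Rightarrow> real" where
  "sqn d v = (\<Sum>i<d. (v i)\<^sup>2)"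

lemma sqn_nonneg [simp]: "0 \<le> sqn d v"
  by (simp add: sqn_def sum_nonneg)

lemma L2_set_power2: "(L2_set v {..<d})\<^sup>2 = sqn d v"
  by (simp add: L2_set_def sqn_def sum_nonneg)

lemma lin_power2_le: "(lin d v \<xi>)\<^sup>2 \<le> sqn d v * sqn d \<xi>"
  unfolding lin_def sqn_def by (rule Cauchy_Schwarz_ineq_sum)

lemma lin_cong: "(\<And>i. i < d \<Longrightarrow> \<xi> i = \<xi>' i) \<Longrightarrow> lin d v \<xi> = lin d v \<xi>'"
  by (simp add: lin_def)

lemma lin_diff: "lin d v (\<lambda>i. \<xi> i - \<eta> i) = lin d v \<xi> - lin d v \<eta>"
  by (simp add: lin_def sum_subtractf right_diff_distrib)

lemma lin_add: "lin d v (\<lambda>i. \<xi> i + \<eta> i) = lin d v \<xi> + lin d v \<eta>"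
  by (simp add: lin_def sum.distrib distrib_left)

text \<open>Young's inequality with a free weight \<kappa>. Being pointwise, it replaces Minkowski's
  inequality in L2 and can be integrated in \<open>ennreal\<close> before finiteness is
  known.\<close>

lemma lin_power2_split:
  assumes "\<kappa> > 0"
  shows "(lin d v \<eta>)\<^sup>2 \<le> (1 + \<kappa>) * (lin d v \<xi>)\<^sup>2 + (1 + 1 / \<kappa>) * (sqn d v * sqn d (\<lambda>i. \<xi> i - \<eta> i))"
proof -
  let ?x = "lin d v \<xi>" and ?z = "lin d v (\<lambda>i. \<xi> i - \<eta> i)"
  have "0 \<le> (sqrt \<kappa> * ?x + ?z / sqrt \<kappa>)\<^sup>2" by simp
  also have "\<dots> = \<kappa> * ?x\<^sup>2 + 2 * ?x * ?z + ?z\<^sup>2 / \<kappa>"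
    using assms by (simp add: power2_sum power_mult_distrib power_divide)
  finally have "0 \<le> \<kappa> * ?x\<^sup>2 + 2 * ?x * ?z + ?z\<^sup>2 / \<kappa>" .
  moreover have "(lin d v \<eta>)\<^sup>2 = ?x\<^sup>2 - 2 * ?x * ?z + ?z\<^sup>2"
    by (simp add: lin_diff power2_eq_square algebra_simps)
  moreover have "(1 + \<kappa>) * ?x\<^sup>2 + (1 + 1 / \<kappa>) * ?z\<^sup>2 = ?x\<^sup>2 + \<kappa> * ?x\<^sup>2 + (?z\<^sup>2 + ?z\<^sup>2 / \<kappa>)"
    by (simp add: distrib_right)
  ultimately have "(lin d v \<eta>)\<^sup>2 \<le> (1 + \<kappa>) * ?x\<^sup>2 + (1 + 1 / \<kappa>) * ?z\<^sup>2" by linarith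
  also have "\<dots> \<le> (1 + \<kappa>) * ?x\<^sup>2 + (1 + 1 / \<kappa>) * (sqn d v * sqn d (\<lambda>i. \<xi> i - \<eta> i))"
    using assms by (intro add_left_mono mult_left_mono[OF lin_power2_le]) simp
  finally show ?thesis .
qed

lemma Rd_component_measurable [measurable]: "i < d \<Longrightarrow> (\<lambda>\<xi>. \<xi> i) \<in> borel_measurable (Rd d)"
  unfolding Rd_def by simp

lemma lin_measurable [measurable]: "lin d v \<in> borel_measurable (Rd d)"
  unfolding lin_def by (intro borel_measurable_sum borel_measurable_times) auto

lemma sqn_measurable [measurable]: "sqn d \<in> borel_measurable (Rd d)"
  unfolding sqn_def by (intro borel_measurable_sum borel_measurable_power) auto

lemma sqn_diff_measurable [measurable]:
  "(\<lambda>z. sqn d (\<lambda>i. fst z i - snd z i)) \<in> borel_measurable (Rd d \<Otimes>\<^sub>M Rd d)"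
proof -
  have "(\<lambda>z. fst z i) \<in> borel_measurable (Rd d \<Otimes>\<^sub>M Rd d)"
    "(\<lambda>z. snd z i) \<in> borel_measurable (Rd d \<Otimes>\<^sub>M Rd d)" if "i < d" for i
    using measurable_compose[OF measurable_fst Rd_component_measurable[OF that]]
      measurable_compose[OF measurable_snd Rd_component_measurable[OF that]] by auto
  then show ?thesis unfolding sqn_def by (intro borel_measurable_sum borel_measurable_power
    borel_measurable_diff) auto
qed

lemma space_Rd: "space (Rd d) = {..<d} \<rightarrow>\<^sub>E UNIV"
  by (simp add: Rd_def space_PiM)

lemma ennreal_sqrt_le_iff:
  assumes "\<rho> \<ge> 0"
  shows "ennreal_sqrt c \<le> ennreal \<rho> \<longleftrightarrow> c \<le> ennreal (\<rho>\<^sup>2)"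
proof (cases c)
  case (real r)
  moreover have "sqrt r \<le> \<rho> \<longleftrightarrow> r \<le> \<rho>\<^sup>2"
    using assms by (metis abs_of_nonneg real_sqrt_abs real_sqrt_le_iff)
  ultimately show ?thesis using assms by (simp add: ennreal_sqrt_def)
next
  case top
  then show ?thesis by (simp add: ennreal_sqrt_def top_unique)
qed

text \<open>The added term is (\<beta> + \<rho>)^2 - \<beta>^2 times \<open>sqn d v\<close>. It
  results from Young's inequality with weight \<kappa> = \<rho> / \<beta>, integrated against a
  nearly optimal coupling. A single slack e > 0 serves two purposes: the infimum over couplings need
  not be attained, and \<beta> may be zero, so \<beta> + e is used as denominator. Finally e tends
  to 0.\<close>

lemma wasserstein_ball_second_moment:
  assumes Q: "Q \<in> wasserstein_ball d \<rho> P0" and \<rho>: "\<rho> > 0" and \<beta>: "\<beta> \<ge> 0"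
    and m: "(\<integral>\<^sup>+\<xi>. ennreal ((lin d v \<xi>)\<^sup>2) \<partial>P0) = ennreal m" "0 \<le> m" "m \<le> \<beta>\<^sup>2 * sqn d v"
  shows "(\<integral>\<^sup>+\<xi>. ennreal ((lin d v \<xi>)\<^sup>2) \<partial>Q) \<le> ennreal (m + \<rho> * (2 * \<beta> + \<rho>) * sqn d v)"
proof -
  let ?n = "sqn d v"
  let ?cost = "\<lambda>\<pi>. \<integral>\<^sup>+ (\<xi>, \<eta>). ennreal ((L2_set (\<lambda>i. \<xi> i - \<eta> i) {..<d})\<^sup>2) \<partial>\<pi>"
  let ?A = "\<integral>\<^sup>+\<xi>. ennreal ((lin d v \<xi>)\<^sup>2) \<partial>Q"
  have W: "(INF \<pi> \<in> couplings d P0 Q. ?cost \<pi>) \<le> ennreal (\<rho>\<^sup>2)"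
    using Q \<rho> unfolding wasserstein_ball_def wasserstein2_def by (simp add: ennreal_sqrt_le_iff)
  have step: "?A \<le> ennreal ((1 + \<kappa>) * m + (1 + 1 / \<kappa>) * (?n * (\<rho>\<^sup>2 + e)))"
    if \<kappa>: "\<kappa> > 0" and e: "e > 0" for \<kappa> e
  proof -
    have "ennreal (\<rho>\<^sup>2) < ennreal (\<rho>\<^sup>2 + e)" using e by (simp add: ennreal_less_iff)
    with W obtain \<pi> where pi: "\<pi> \<in> couplings d P0 Q" "?cost \<pi> < ennreal (\<rho>\<^sup>2 + e)"
      by (meson INF_less_iff order_le_less_trans)
    have s[measurable_cong]: "sets \<pi> = sets (Rd d \<Otimes>\<^sub>M Rd d)"
      and d1: "distr \<pi> (Rd d) fst = P0" and d2: "distr \<pi> (Rd d) snd = Q"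
      using pi(1) by (auto simp: couplings_def)
    have "?A = (\<integral>\<^sup>+z. ennreal ((lin d v (snd z))\<^sup>2) \<partial>\<pi>)"
      unfolding d2[symmetric] by (subst nn_integral_distr) auto
    also have "\<dots> \<le> (\<integral>\<^sup>+z. ennreal (1 + \<kappa>) * ennreal ((lin d v (fst z))\<^sup>2)
        + ennreal ((1 + 1 / \<kappa>) * ?n) * ennreal (sqn d (\<lambda>i. fst z i - snd z i)) \<partial>\<pi>)"
      using \<kappa> lin_power2_split[OF \<kappa>]
      by (intro nn_integral_mono)
        (simp add: ennreal_mult[symmetric] ennreal_plus[symmetric] mult.assoc del: ennreal_plus)
    also have "\<dots> = ennreal (1 + \<kappa>) * (\<integral>\<^sup>+z. ennreal ((lin d v (fst z))\<^sup>2) \<partial>\<pi>)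
        + ennreal ((1 + 1 / \<kappa>) * ?n) * (\<integral>\<^sup>+z. ennreal (sqn d (\<lambda>i. fst z i - snd z i)) \<partial>\<pi>)"
      by (simp add: nn_integral_add nn_integral_cmult)
    also have "(\<integral>\<^sup>+z. ennreal ((lin d v (fst z))\<^sup>2) \<partial>\<pi>) = ennreal m"
      unfolding m(1)[symmetric] d1[symmetric] by (subst nn_integral_distr) auto
    also have "(\<integral>\<^sup>+z. ennreal (sqn d (\<lambda>i. fst z i - snd z i)) \<partial>\<pi>) = ?cost \<pi>"
      by (simp add: L2_set_power2 case_prod_unfold)
    also have "ennreal (1 + \<kappa>) * ennreal m + ennreal ((1 + 1 / \<kappa>) * ?n) * ?cost \<pi>
      \<le> ennreal (1 + \<kappa>) * ennreal m + ennreal ((1 + 1 / \<kappa>) * ?n) * ennreal (\<rho>\<^sup>2 + e)"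
      using pi(2) by (intro add_left_mono mult_left_mono) auto
    also have "\<dots> = ennreal ((1 + \<kappa>) * m + (1 + 1 / \<kappa>) * (?n * (\<rho>\<^sup>2 + e)))"
      using \<kappa> e m(2)
      by (simp add: ennreal_mult[symmetric] ennreal_plus[symmetric] mult.assoc del: ennreal_plus)
    finally show ?thesis .
  qed
  \<comment> \<open>Any instance of \<open>step\<close> shows that the moment is finite, so the rest
    is real arithmetic.\<close>
  obtain a where a: "?A = ennreal a" "a \<ge> 0"
    using step[of 1 1] by (cases ?A) (auto simp: top_unique)
  have le: "a \<le> m + \<rho> * (2 * (\<beta> + e) + \<rho>) * ?n + (1 + (\<beta> + e) / \<rho>) * (?n * e)"
    if e: "e > 0" for e
  proof -
    let ?b = "\<beta> + e"
    have b: "?b > 0" using e \<beta> by simp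
    have "a \<le> (1 + \<rho> / ?b) * m + (1 + ?b / \<rho>) * (?n * (\<rho>\<^sup>2 + e))"
    proof -
      have "ennreal a \<le> ennreal ((1 + \<rho> / ?b) * m + (1 + ?b / \<rho>) * (?n * (\<rho>\<^sup>2 + e)))"
        using step[of "\<rho> / ?b" e] b \<rho> e unfolding a(1) by simp
      then show ?thesis using b \<rho> e m(2) by (subst (asm) ennreal_le_iff) auto
    qed
    \<comment> \<open>The bound is needed only for the extra part \<open>\<rho> / ?b * m\<close>;
      the leading \<open>m\<close> stays as it is, so the final estimate is an increment over
      \<open>m\<close>.\<close>
    moreover have "m \<le> ?b\<^sup>2 * ?n"
      by (rule order_trans[OF m(3)]) (use \<beta> e in \<open>auto intro!: mult_right_mono power_mono\<close>)
    then have "\<rho> / ?b * m \<le> \<rho> / ?b * (?b\<^sup>2 * ?n)"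
      using b \<rho> by (intro mult_left_mono) auto
    moreover have "\<rho> / ?b * (?b\<^sup>2 * ?n) = \<rho> * ?b * ?n"
      using b by (simp add: power2_eq_square)
    moreover have "(1 + \<rho> / ?b) * m = m + \<rho> / ?b * m" by (simp only: distrib_right mult_1)
    ultimately have "a \<le> m + \<rho> * ?b * ?n + (1 + ?b / \<rho>) * (?n * (\<rho>\<^sup>2 + e))" by linarith
    moreover have k: "(1 + ?b / \<rho>) * \<rho>\<^sup>2 = \<rho> * (?b + \<rho>)"
      using \<rho> by (simp add: field_simps power2_eq_square)
    have "(1 + ?b / \<rho>) * (?n * (\<rho>\<^sup>2 + e))
        = (1 + ?b / \<rho>) * \<rho>\<^sup>2 * ?n + (1 + ?b / \<rho>) * (?n * e)"
      by (simp add: distrib_left mult.assoc mult.left_commute[of ?n])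
    note this[unfolded k]
    moreover have "\<rho> * ?b * ?n + \<rho> * (?b + \<rho>) * ?n = \<rho> * (2 * ?b + \<rho>) * ?n"
      by (simp add: distrib_left distrib_right)
    ultimately show ?thesis by linarith
  qed
  have "((\<lambda>e. m + \<rho> * (2 * (\<beta> + e) + \<rho>) * ?n + (1 + (\<beta> + e) / \<rho>) * (?n * e))
      \<longlongrightarrow> m + \<rho> * (2 * (\<beta> + 0) + \<rho>) * ?n + (1 + (\<beta> + 0) / \<rho>) * (?n * 0)) (at_right 0)"
    using \<rho> by (intro tendsto_intros) auto
  then have "a \<le> m + \<rho> * (2 * (\<beta> + 0) + \<rho>) * ?n + (1 + (\<beta> + 0) / \<rho>) * (?n * 0)"
    by (rule tendsto_lowerbound, intro eventually_at_rightI[of 0 1] le) auto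
  then show ?thesis unfolding a(1) by (intro ennreal_leI) simp
qed

section \<open>Laws with finitely many atoms: the centered empirical law and its inflation\<close>

lemma nn_integral_distr_uniform_count:
  assumes A: "finite A" "A \<noteq> {}" and f: "f \<in> A \<rightarrow> space M"
    and g: "g \<in> borel_measurable M" "\<And>x. 0 \<le> (g x :: real)"
  shows "(\<integral>\<^sup>+x. ennreal (g x) \<partial>distr (uniform_count_measure A) M f)
    = ennreal ((\<Sum>a\<in>A. g (f a)) / real (card A))"
proof -
  have fm[measurable]: "f \<in> measurable (uniform_count_measure A) M"
    using f by (auto simp: measurable_def sets_uniform_count_measure space_uniform_count_measure)
  have "(\<integral>\<^sup>+x. ennreal (g x) \<partial>distr (uniform_count_measure A) M f)
      = (\<Sum>a\<in>A. ennreal (1 / real (card A)) * ennreal (g (f a)))"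
    using A g(1)
    by (subst nn_integral_distr[OF fm])
      (auto simp: uniform_count_measure_def nn_integral_point_measure_finite)
  also have "\<dots> = ennreal ((\<Sum>a\<in>A. g (f a)) / real (card A))"
    using g(2) by (simp add: ennreal_mult[symmetric] sum_ennreal sum_divide_distrib)
  finally show ?thesis .
qed

lemma integral_distr_uniform_count:
  assumes A: "finite A" "A \<noteq> {}" and f: "f \<in> A \<rightarrow> space M"
    and g: "(g :: _ \<Rightarrow> real) \<in> borel_measurable M"
  shows "integrable (distr (uniform_count_measure A) M f) g"
    and "(\<integral>x. g x \<partial>distr (uniform_count_measure A) M f) = (\<Sum>a\<in>A. g (f a)) / real (card A)"
proof -
  have fm[measurable]: "f \<in> measurable (uniform_count_measure A) M"
    using f by (auto simp: measurable_def sets_uniform_count_measure space_uniform_count_measure)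
  show "integrable (distr (uniform_count_measure A) M f) g"
    using A g
    by (subst integrable_distr_eq[OF fm])
      (auto simp: uniform_count_measure_def integrable_point_measure_finite)
  show "(\<integral>x. g x \<partial>distr (uniform_count_measure A) M f) = (\<Sum>a\<in>A. g (f a)) / real (card A)"
    using A g by (simp add: integral_distr[OF fm] integral_uniform_count_measure)
qed

lemma prob_space_distr_uniform_count:
  assumes A: "finite A" "A \<noteq> {}" and f: "f \<in> A \<rightarrow> space M"
  shows "prob_space (distr (uniform_count_measure A) M f)"
  using prob_space_uniform_count_measure[OF A] f
  by (intro prob_space.prob_space_distr)
    (auto simp: measurable_def sets_uniform_count_measure space_uniform_count_measure)

text \<open>The atoms of \<open>centered_empirical\<close>. They are restricted to
  \<open>{..<d}\<close> because points of \<open>Rd d\<close> are extensional functions.\<close>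

definition centered :: "nat \<Rightarrow> nat \<Rightarrow> (nat \<Rightarrow> nat \<Rightarrow> real) \<Rightarrow> nat \<Rightarrow> nat \<Rightarrow> real" where
  "centered d N \<omega> k = (\<lambda>i\<in>{..<d}. \<omega> k i - (\<Sum>l=1..N. \<omega> l i) / real N)"

lemma centered_empirical_eq:
  "centered_empirical d N \<omega> = distr (uniform_count_measure {1..N}) (Rd d) (centered d N \<omega>)"
  by (simp add: centered_empirical_def centered_def[abs_def])

lemma centered_space: "centered d N \<omega> k \<in> space (Rd d)"
  by (simp add: centered_def space_Rd)

lemma sum_centered:
  assumes "N \<ge> 1" "i < d"
  shows "(\<Sum>k=1..N. centered d N \<omega> k i) = 0"
  using assms by (simp add: centered_def sum_subtractf)

lemma lin_centered:
  "lin d v (centered d N \<omega> k) = lin d v (\<omega> k) - lin d v (\<lambda>i. (\<Sum>l=1..N. \<omega> l i) / real N)"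
  unfolding lin_diff[symmetric] by (rule lin_cong) (simp add: centered_def)

lemma sum_lin_centered:
  assumes "N \<ge> 1"
  shows "(\<Sum>k=1..N. lin d v (centered d N \<omega> k)) = 0"
  unfolding lin_def by (subst sum.swap) (simp add: sum_distrib_left[symmetric] sum_centered[OF assms, simplified])

text \<open>The atoms of the empirical law are spread along the coordinate axes by \<open>\<plusminus> \<rho>\<close>. Every atom moves by
  exactly \<open>\<rho>\<close>, and the covariance grows by \<open>(\<rho>\<^sup>2 / d) I\<close>.\<close>

definition inflated :: "nat \<Rightarrow> nat \<Rightarrow> real \<Rightarrow> (nat \<Rightarrow> nat \<Rightarrow> real)
    \<Rightarrow> nat \<times> nat \<times> real \<Rightarrow> nat \<Rightarrow> real" where
  "inflated d N \<rho> \<omega> = (\<lambda>(k, a, s). \<lambda>i\<in>{..<d}. centered d N \<omega> k i + (if i = a then s * \<rho> else 0))"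

lemma inflated_space: "inflated d N \<rho> \<omega> z \<in> space (Rd d)"
  by (cases z) (simp add: inflated_def space_Rd)

definition inflated_empirical ::
  "nat \<Rightarrow> nat \<Rightarrow> real \<Rightarrow> (nat \<Rightarrow> nat \<Rightarrow> real) \<Rightarrow> (nat \<Rightarrow> real) measure" where
  "inflated_empirical d N \<rho> \<omega> =
    distr (uniform_count_measure ({1..N} \<times> {..<d} \<times> {-1, 1})) (Rd d) (inflated d N \<rho> \<omega>)"

lemma sum_times_signs:
  fixes h :: "'a \<times> 'b \<times> real \<Rightarrow> real"
  shows "(\<Sum>z\<in>A \<times> B \<times> {-1, 1}. h z) = (\<Sum>k\<in>A. \<Sum>a\<in>B. h (k, a, -1) + h (k, a, 1))"
proof -
  have "(\<Sum>z\<in>A \<times> B \<times> {-1, 1}. h z) = (\<Sum>k\<in>A. \<Sum>a\<in>B. \<Sum>s\<in>{-1, 1}. h (k, a, s))"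
    unfolding sum.cartesian_product by (intro sum.cong) auto
  then show ?thesis by simp
qed

text \<open>Pairing each atom with its displaced copies is a coupling in which every pair is at
  distance \<rho>. The opposite signs keep the mean at zero, which membership in the ball
  requires.\<close>

lemma inflated_in_ball:
  assumes N: "N \<ge> 1" and d: "d > 0" and \<rho>: "\<rho> \<ge> 0"
  shows "inflated_empirical d N \<rho> \<omega> \<in> wasserstein_ball d \<rho> (centered_empirical d N \<omega>)"
proof -
  let ?A = "{1..N} \<times> {..<d} \<times> {-1, 1::real}"
  let ?c = "centered d N \<omega>" and ?f = "inflated d N \<rho> \<omega>"
  let ?Q = "inflated_empirical d N \<rho> \<omega>"
  have A: "finite ?A" "?A \<noteq> {}" using N d by auto
  have cA: "card ?A = N * (d * 2)" by (simp add: card_cartesian_product)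
  have f: "?f \<in> ?A \<rightarrow> space (Rd d)" using inflated_space by blast
  note sumA = sum_times_signs[of _ "{1..N}" "{..<d}"]
  have "(\<integral>\<xi>. \<xi> i \<partial>?Q) = 0" if i: "i < d" for i
  proof -
    have "(\<Sum>z\<in>?A. ?f z i) = (\<Sum>k=1..N. \<Sum>a<d. 2 * ?c k i)"
      unfolding sumA using i by (intro sum.cong) (auto simp: inflated_def)
    also have "\<dots> = 2 * real d * (\<Sum>k=1..N. ?c k i)" by (simp add: sum_distrib_left mult_ac)
    also have "\<dots> = 0" by (simp add: sum_centered[OF N i, simplified])
    finally show ?thesis
      unfolding inflated_empirical_def
      using integral_distr_uniform_count(2)[OF A f, of "\<lambda>\<xi>. \<xi> i"] i by simp
  qed
  moreover have "prob_space ?Q"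
    unfolding inflated_empirical_def by (rule prob_space_distr_uniform_count[OF A f])
  moreover have "integrable ?Q (\<lambda>\<xi>. \<xi> i)" if "i < d" for i
    unfolding inflated_empirical_def
    by (rule integral_distr_uniform_count(1)[OF A f]) (rule Rd_component_measurable[OF that])
  moreover have "sets ?Q = sets (Rd d)" by (simp add: inflated_empirical_def)
  ultimately have zm: "?Q \<in> zero_mean_dists d"
    by (simp add: zero_mean_dists_def)
  define \<pi> where "\<pi> = distr (uniform_count_measure ?A) (Rd d \<Otimes>\<^sub>M Rd d) (\<lambda>z. (?c (fst z), ?f z))"
  have pf: "(\<lambda>z. (?c (fst z), ?f z)) \<in> ?A \<rightarrow> space (Rd d \<Otimes>\<^sub>M Rd d)"
    using f centered_space by (auto simp: space_pair_measure)
  have pm: "(\<lambda>z. (?c (fst z), ?f z)) \<in> measurable (uniform_count_measure ?A) (Rd d \<Otimes>\<^sub>M Rd d)"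
    using pf by (auto simp: measurable_def sets_uniform_count_measure space_uniform_count_measure)
  have d1: "distr \<pi> (Rd d) fst = centered_empirical d N \<omega>"
  proof (rule measure_eqI)
    fix X assume "X \<in> sets (distr \<pi> (Rd d) fst)"
    then have X[measurable]: "X \<in> sets (Rd d)" by simp
    have c1: "(\<lambda>z. ?c (fst z)) \<in> ?A \<rightarrow> space (Rd d)" using centered_space by auto
    have "distr \<pi> (Rd d) fst = distr (uniform_count_measure ?A) (Rd d) (\<lambda>z. ?c (fst z))"
      unfolding \<pi>_def by (subst distr_distr[OF measurable_fst pm]) (simp add: comp_def)
    then have "emeasure (distr \<pi> (Rd d) fst) X
        = (\<integral>\<^sup>+x. ennreal (indicator X x) \<partial>distr (uniform_count_measure ?A) (Rd d) (\<lambda>z. ?c (fst z)))"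
      using X by (simp add: ennreal_indicator)
    also have "\<dots> = ennreal ((\<Sum>z\<in>?A. indicator X (?c (fst z))) / real (card ?A))"
      by (rule nn_integral_distr_uniform_count[OF A c1]) auto
    \<comment> \<open>Every k occurs with the same number 2 d of axes and signs, so forgetting them
      leaves the uniform law on the sample indices.\<close>
    also have "\<dots> = ennreal ((\<Sum>k\<in>{1..N}. indicator X (?c k)) / real (card {1..N}))"
      unfolding sumA cA using d by (simp add: sum_distrib_left[symmetric])
    also have "\<dots> = (\<integral>\<^sup>+x. ennreal (indicator X x) \<partial>centered_empirical d N \<omega>)"
      unfolding centered_empirical_eq using N centered_space
      by (subst nn_integral_distr_uniform_count) auto
    also have "\<dots> = emeasure (centered_empirical d N \<omega>) X"
      using X by (simp add: centered_empirical_eq ennreal_indicator)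
    finally show "emeasure (distr \<pi> (Rd d) fst) X = emeasure (centered_empirical d N \<omega>) X" .
  qed (simp add: centered_empirical_eq)
  have d2: "distr \<pi> (Rd d) snd = ?Q"
    unfolding \<pi>_def inflated_empirical_def
    by (subst distr_distr[OF measurable_snd pm]) (simp add: comp_def)
  have coup: "\<pi> \<in> couplings d (centered_empirical d N \<omega>) ?Q"
    using d1 d2 by (simp add: couplings_def \<pi>_def)
  have "(\<integral>\<^sup>+ (\<xi>, \<eta>). ennreal ((L2_set (\<lambda>i. \<xi> i - \<eta> i) {..<d})\<^sup>2) \<partial>\<pi>)
      = (\<integral>\<^sup>+ z. ennreal (sqn d (\<lambda>i. fst z i - snd z i)) \<partial>\<pi>)"
    by (simp add: L2_set_power2 case_prod_unfold)
  also have "\<dots> = ennreal ((\<Sum>z\<in>?A. sqn d (\<lambda>i. ?c (fst z) i - ?f z i)) / real (card ?A))"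
    unfolding \<pi>_def by (subst nn_integral_distr_uniform_count[OF A pf]) auto
  also have "(\<Sum>z\<in>?A. sqn d (\<lambda>i. ?c (fst z) i - ?f z i)) = (\<Sum>z\<in>?A. \<rho>\<^sup>2)"
  proof (rule sum.cong[OF refl])
    fix z assume "z \<in> ?A"
    then obtain k a s where z: "z = (k, a, s)" "a < d" "s = 1 \<or> s = -1" by auto
    have "sqn d (\<lambda>i. ?c (fst z) i - ?f z i) = (\<Sum>i<d. if i = a then \<rho>\<^sup>2 else 0)"
      unfolding sqn_def using z by (intro sum.cong) (auto simp: inflated_def)
    also have "\<dots> = \<rho>\<^sup>2" using z by simp
    finally show "sqn d (\<lambda>i. ?c (fst z) i - ?f z i) = \<rho>\<^sup>2" .
  qed
  also have "(\<Sum>z\<in>?A. \<rho>\<^sup>2) / real (card ?A) = \<rho>\<^sup>2" using N d by simp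
  finally have "(INF \<pi> \<in> couplings d (centered_empirical d N \<omega>) ?Q.
      \<integral>\<^sup>+ (\<xi>, \<eta>). ennreal ((L2_set (\<lambda>i. \<xi> i - \<eta> i) {..<d})\<^sup>2) \<partial>\<pi>) \<le> ennreal (\<rho>\<^sup>2)"
    using coup by (intro INF_lower2[of \<pi>]) auto
  then show ?thesis
    using zm \<rho> by (simp add: wasserstein_ball_def wasserstein2_def ennreal_sqrt_le_iff)
qed

text \<open>The two signs cancel the cross term, and averaging the squares
  \<open>(v a)\<^sup>2\<close> over the d axes gives \<open>sqn d v / d\<close>.\<close>

lemma inflated_second_moment:
  assumes N: "N \<ge> 1" and d: "d > 0"
  shows "(\<integral>\<^sup>+\<xi>. ennreal ((lin d v \<xi>)\<^sup>2) \<partial>inflated_empirical d N \<rho> \<omega>)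
    = ennreal ((\<Sum>k=1..N. (lin d v (centered d N \<omega> k))\<^sup>2) / real N + \<rho>\<^sup>2 / real d * sqn d v)"
proof -
  let ?A = "{1..N} \<times> {..<d} \<times> {-1, 1::real}"
  let ?c = "centered d N \<omega>" and ?f = "inflated d N \<rho> \<omega>"
  have A: "finite ?A" "?A \<noteq> {}" using N d by auto
  have cA: "card ?A = N * (d * 2)" by (simp add: card_cartesian_product)
  have f: "?f \<in> ?A \<rightarrow> space (Rd d)" using inflated_space by blast
  note sumA = sum_times_signs[of _ "{1..N}" "{..<d}"]
  have l: "lin d v (?f (k, a, s)) = lin d v (?c k) + s * \<rho> * v a" if "a < d" for k a s
  proof -
    have "lin d v (?f (k, a, s)) = lin d v (\<lambda>i. ?c k i + (if i = a then s * \<rho> else 0))"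
      by (rule lin_cong) (simp add: inflated_def)
    also have "lin d v (\<lambda>i. if i = a then s * \<rho> else 0) = s * \<rho> * v a"
      using that by (simp add: lin_def if_distrib[of "\<lambda>x. _ * x"] cong: if_cong)
    then have "lin d v (\<lambda>i. ?c k i + (if i = a then s * \<rho> else 0)) = lin d v (?c k) + s * \<rho> * v a"
      by (simp add: lin_add)
    finally show ?thesis .
  qed
  have "(\<integral>\<^sup>+\<xi>. ennreal ((lin d v \<xi>)\<^sup>2) \<partial>inflated_empirical d N \<rho> \<omega>)
      = ennreal ((\<Sum>z\<in>?A. (lin d v (?f z))\<^sup>2) / real (card ?A))"
    unfolding inflated_empirical_def by (rule nn_integral_distr_uniform_count[OF A f]) auto
  also have "(\<Sum>z\<in>?A. (lin d v (?f z))\<^sup>2)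
      = (\<Sum>k=1..N. \<Sum>a<d. 2 * (lin d v (?c k))\<^sup>2 + 2 * \<rho>\<^sup>2 * (v a)\<^sup>2)"
    unfolding sumA by (intro sum.cong) (auto simp: l power2_eq_square algebra_simps)
  also have "\<dots> = 2 * real d * (\<Sum>k=1..N. (lin d v (?c k))\<^sup>2) + 2 * real N * \<rho>\<^sup>2 * sqn d v"
    by (simp add: sum.distrib sum_distrib_left[symmetric] sqn_def mult_ac)
  also have "\<dots> / real (card ?A)
      = (\<Sum>k=1..N. (lin d v (?c k))\<^sup>2) / real N + \<rho>\<^sup>2 / real d * sqn d v"
    unfolding cA using N d by (simp add: field_simps)
  finally show ?thesis .
qed

text \<open>The Wasserstein estimate uses the \<open>ennreal\<close> integral, the covariance matrix
  the Bochner integral.\<close>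

lemma centered_second_moment:
  assumes N: "N \<ge> 1"
  shows "(\<integral>\<^sup>+\<xi>. ennreal ((lin d v \<xi>)\<^sup>2) \<partial>centered_empirical d N \<omega>)
      = ennreal ((\<Sum>k=1..N. (lin d v (centered d N \<omega> k))\<^sup>2) / real N)"
    and "(\<integral>\<xi>. (lin d v \<xi>)\<^sup>2 \<partial>centered_empirical d N \<omega>)
      = (\<Sum>k=1..N. (lin d v (centered d N \<omega> k))\<^sup>2) / real N"
proof -
  have c: "centered d N \<omega> \<in> {1..N} \<rightarrow> space (Rd d)" "finite {1..N}" "{1..N} \<noteq> {}"
    using N centered_space by auto
  show "(\<integral>\<^sup>+\<xi>. ennreal ((lin d v \<xi>)\<^sup>2) \<partial>centered_empirical d N \<omega>)
      = ennreal ((\<Sum>k=1..N. (lin d v (centered d N \<omega> k))\<^sup>2) / real N)"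
    unfolding centered_empirical_eq by (subst nn_integral_distr_uniform_count[OF c(2,3,1)]) auto
  show "(\<integral>\<xi>. (lin d v \<xi>)\<^sup>2 \<partial>centered_empirical d N \<omega>)
      = (\<Sum>k=1..N. (lin d v (centered d N \<omega> k))\<^sup>2) / real N"
    unfolding centered_empirical_eq by (subst integral_distr_uniform_count[OF c(2,3,1)]) auto
qed

section \<open>Covariance matrices as quadratic forms of second moments\<close>

lemma cov_mat_carrier [simp]: "cov_mat d P \<in> carrier_mat d d"
  by (simp add: cov_mat_def)

lemma cov_mat_symmetric [simp]: "transpose_mat (cov_mat d P) = cov_mat d P"
  by (rule eq_matI) (auto simp: cov_mat_def mult.commute)

lemma cov_mat_quadratic_form:
  assumes zm: "\<And>i. i < d \<Longrightarrow> (\<integral>\<xi>. \<xi> i \<partial>P) = 0"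
    and int: "\<And>i j. i < d \<Longrightarrow> j < d \<Longrightarrow> integrable P (\<lambda>\<xi>. \<xi> i * \<xi> j)"
  shows "vec d v \<bullet> (cov_mat d P *\<^sub>v vec d v) = (\<integral>\<xi>. (lin d v \<xi>)\<^sup>2 \<partial>P)"
    and "integrable P (\<lambda>\<xi>. (lin d v \<xi>)\<^sup>2)"
proof -
  have e: "(lin d v \<xi>)\<^sup>2 = (\<Sum>i<d. \<Sum>j<d. v i * v j * (\<xi> i * \<xi> j))" for \<xi>
    by (simp add: lin_def power2_eq_square sum_product mult_ac)
  show "integrable P (\<lambda>\<xi>. (lin d v \<xi>)\<^sup>2)"
    unfolding e by (intro Bochner_Integration.integrable_sum integrable_mult_right int) auto
  have int1: "integrable P (\<lambda>\<xi>. \<Sum>j<d. v i * v j * (\<xi> i * \<xi> j))" if "i < d" for i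
    using that by (intro Bochner_Integration.integrable_sum integrable_mult_right int) auto
  have "(\<integral>\<xi>. (lin d v \<xi>)\<^sup>2 \<partial>P) = (\<Sum>i<d. \<Sum>j<d. v i * v j * (\<integral>\<xi>. \<xi> i * \<xi> j \<partial>P))"
    unfolding e
    using int1 int by (simp add: Bochner_Integration.integral_sum[where M = P])
  also have "\<dots> = vec d v \<bullet> (cov_mat d P *\<^sub>v vec d v)"
    by (auto simp: scalar_prod_def cov_mat_def zm lessThan_atLeast0 sum_distrib_left mult_ac
      intro!: sum.cong)
  finally show "vec d v \<bullet> (cov_mat d P *\<^sub>v vec d v) = (\<integral>\<xi>. (lin d v \<xi>)\<^sup>2 \<partial>P)" by simp
qed

lemma vec_scalar_prod_self: "vec d v \<bullet> vec d v = sqn d v"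
  by (simp add: scalar_prod_def sqn_def lessThan_atLeast0 power2_eq_square)

lemma cov_mat_centered_empirical:
  assumes N: "N \<ge> 1"
  shows "vec d v \<bullet> (cov_mat d (centered_empirical d N \<omega>) *\<^sub>v vec d v)
    = (\<Sum>k=1..N. (lin d v (centered d N \<omega> k))\<^sup>2) / real N"
proof -
  have c: "centered d N \<omega> \<in> {1..N} \<rightarrow> space (Rd d)" "finite {1..N}" "{1..N} \<noteq> {}"
    using N centered_space by auto
  show ?thesis
  proof (subst cov_mat_quadratic_form(1))
    show "(\<integral>\<xi>. \<xi> i \<partial>centered_empirical d N \<omega>) = 0" if "i < d" for i
      unfolding centered_empirical_eq
      using integral_distr_uniform_count(2)[OF c(2,3,1), of "\<lambda>\<xi>. \<xi> i"] that
      by (simp add: sum_centered[OF N, simplified])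
    show "integrable (centered_empirical d N \<omega>) (\<lambda>\<xi>. \<xi> i * \<xi> j)" if "i < d" "j < d" for i j
      unfolding centered_empirical_eq
      using integral_distr_uniform_count(1)[OF c(2,3,1), of "\<lambda>\<xi>. \<xi> i * \<xi> j"] that by simp
  qed (rule centered_second_moment(2)[OF N])
qed

subsection \<open>Concentration of second moments\<close>

text \<open>Exponential Markov inequality; independence enters as factorization of the integral over
  the product measure. The Chernoff parameter is part of \<open>X\<close>, so a caller passes an
  already scaled variable.\<close>

lemma Chernoff_product:
  fixes X :: "'a \<Rightarrow> real"
  assumes P: "prob_space P" and I: "finite I" and X[measurable]: "X \<in> borel_measurable P"
    and C: "(\<integral>\<^sup>+\<xi>. ennreal (exp (X \<xi>)) \<partial>P) \<le> ennreal C" "0 \<le> C"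
  shows "emeasure (\<Pi>\<^sub>M k\<in>I. P) {\<omega> \<in> space (\<Pi>\<^sub>M k\<in>I. P). s \<le> (\<Sum>k\<in>I. X (\<omega> k))}
    \<le> ennreal (exp (- s) * C ^ card I)"
proof -
  interpret product_sigma_finite "\<lambda>_. P"
    using P by (simp add: product_sigma_finite_def prob_space_imp_sigma_finite)
  let ?M = "\<Pi>\<^sub>M k\<in>I. P"
  let ?A = "{\<omega> \<in> space ?M. s \<le> (\<Sum>k\<in>I. X (\<omega> k))}"
  have [measurable]: "(\<lambda>\<omega>. X (\<omega> k)) \<in> borel_measurable ?M" if "k \<in> I" for k
    using measurable_compose[OF measurable_component_singleton[OF that] X] .
  have S[measurable]: "(\<lambda>\<omega>. \<Sum>k\<in>I. X (\<omega> k)) \<in> borel_measurable ?M"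
    by (intro borel_measurable_sum) auto
  have A[measurable]: "?A \<in> sets ?M" by measurable
  have "emeasure ?M ?A = (\<integral>\<^sup>+\<omega>. indicator ?A \<omega> \<partial>?M)" using A by simp
  also have "\<dots> \<le> (\<integral>\<^sup>+\<omega>. ennreal (exp (- s)) * (\<Prod>k\<in>I. ennreal (exp (X (\<omega> k)))) \<partial>?M)"
  proof (rule nn_integral_mono)
    fix \<omega>
    have "indicator ?A \<omega> \<le> ennreal (exp ((\<Sum>k\<in>I. X (\<omega> k)) - s))"
      by (auto simp: indicator_def)
    also have "exp ((\<Sum>k\<in>I. X (\<omega> k)) - s) = exp (- s) * (\<Prod>k\<in>I. exp (X (\<omega> k)))"
      using I by (simp add: exp_diff exp_sum exp_minus field_simps)
    finally show "indicator ?A \<omega> \<le> ennreal (exp (- s)) * (\<Prod>k\<in>I. ennreal (exp (X (\<omega> k))))"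
      by (simp add: ennreal_mult prod_nonneg prod_ennreal)
  qed
  also have "\<dots> = ennreal (exp (- s)) * (\<integral>\<^sup>+\<omega>. (\<Prod>k\<in>I. ennreal (exp (X (\<omega> k)))) \<partial>?M)"
    by (intro nn_integral_cmult borel_measurable_prod_ennreal) auto
  also have "(\<integral>\<^sup>+\<omega>. (\<Prod>k\<in>I. ennreal (exp (X (\<omega> k)))) \<partial>?M)
      = (\<Prod>k\<in>I. \<integral>\<^sup>+\<xi>. ennreal (exp (X \<xi>)) \<partial>P)"
    by (rule product_nn_integral_prod[OF I]) auto
  also have "\<dots> \<le> (\<Prod>k\<in>I. ennreal C)" by (intro prod_mono_ennreal C(1))
  also have "\<dots> = ennreal (C ^ card I)" using C(2) by (simp add: ennreal_power)
  finally show ?thesis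
    using C(2) by (simp add: ennreal_mult[symmetric] mult_left_mono)
qed

text \<open>Second-order Taylor expansion whose remainder is paid for by exp |x|: since |l| \<le>
  1/2, one factor exp (|x| / 2) bounds the exponential in the remainder, and the other absorbs x^2
  \<le> 8 exp (|x| / 2).\<close>

lemma exp_le_quadratic_exp_abs:
  fixes x l :: real
  assumes l: "\<bar>l\<bar> \<le> 1 / 2"
  shows "exp (l * x) \<le> 1 + l * x + 4 * l\<^sup>2 * exp \<bar>x\<bar>"
proof -
  obtain t where t: "\<bar>t\<bar> \<le> \<bar>l * x\<bar>"
    "exp (l * x) = (\<Sum>m<2. (l * x) ^ m / fact m) + exp t / fact 2 * (l * x) ^ 2"
    using Maclaurin_exp_le[of "l * x" 2] by blast
  have "\<bar>l * x\<bar> \<le> \<bar>x\<bar> / 2" using mult_right_mono[OF l, of "\<bar>x\<bar>"] by (simp add: abs_mult)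
  then have 1: "exp t \<le> exp (\<bar>x\<bar> / 2)" using t(1) by simp
  have "(\<bar>x\<bar> / 2)\<^sup>2 / 2 \<le> exp (\<bar>x\<bar> / 2)"
    using exp_lower_Taylor_quadratic[of "\<bar>x\<bar> / 2"] by simp
  then have 2: "x\<^sup>2 \<le> 8 * exp (\<bar>x\<bar> / 2)" by (simp add: power_divide)
  have "exp t / 2 * (l * x)\<^sup>2 = l\<^sup>2 / 2 * (exp t * x\<^sup>2)" by (simp add: power_mult_distrib)
  also have "\<dots> \<le> l\<^sup>2 / 2 * (exp (\<bar>x\<bar> / 2) * (8 * exp (\<bar>x\<bar> / 2)))"
    by (intro mult_left_mono mult_mono 1 2) auto
  also have "\<dots> = 4 * l\<^sup>2 * exp \<bar>x\<bar>" by (simp add: exp_add[symmetric])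
  finally show ?thesis using t(2) by (simp add: eval_nat_numeral)
qed

text \<open>Zero mean removes the linear term of the expansion, so the moment generating function
  grows only quadratically in l near 0. Negative l are allowed, which later yields the lower
  tail.\<close>

lemma centered_mgf_bound:
  fixes X :: "'a \<Rightarrow> real"
  assumes P: "prob_space P" and X: "integrable P X" "(\<integral>\<xi>. X \<xi> \<partial>P) = 0"
    and B: "(\<integral>\<^sup>+\<xi>. ennreal (exp \<bar>X \<xi>\<bar>) \<partial>P) \<le> ennreal B" "0 \<le> B"
    and l: "\<bar>l\<bar> \<le> 1 / 2"
  shows "(\<integral>\<^sup>+\<xi>. ennreal (exp (l * X \<xi>)) \<partial>P) \<le> ennreal (exp (4 * B * l\<^sup>2))"
proof -
  interpret prob_space P by fact
  have Xm[measurable]: "X \<in> borel_measurable P" using X(1) by simp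
  have ie: "integrable P (\<lambda>\<xi>. exp \<bar>X \<xi>\<bar>)"
    using B by (intro integrableI_bounded) (auto simp: order_le_less_trans)
  have "(\<integral>\<xi>. exp \<bar>X \<xi>\<bar> \<partial>P) \<le> B"
    using B nn_integral_eq_integral[OF ie] by (simp add: ennreal_le_iff)
  note le = this
  let ?g = "\<lambda>\<xi>. 1 + l * X \<xi> + 4 * l\<^sup>2 * exp \<bar>X \<xi>\<bar>"
  have ig: "integrable P ?g" using X(1) ie by simp
  have "(\<integral>\<^sup>+\<xi>. ennreal (exp (l * X \<xi>)) \<partial>P) \<le> (\<integral>\<^sup>+\<xi>. ennreal (?g \<xi>) \<partial>P)"
    by (intro nn_integral_mono ennreal_leI exp_le_quadratic_exp_abs[OF l])
  also have "\<dots> = ennreal (\<integral>\<xi>. ?g \<xi> \<partial>P)"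
  proof (rule nn_integral_eq_integral[OF ig])
    \<comment> \<open>The linear term may be negative, but \<open>?g\<close> dominates an
      exponential.\<close>
    show "AE \<xi> in P. 0 \<le> ?g \<xi>"
    proof (rule AE_I2)
      fix \<xi> show "0 \<le> ?g \<xi>"
        using exp_le_quadratic_exp_abs[OF l, of "X \<xi>"] exp_gt_zero[of "l * X \<xi>"] by linarith
    qed
  qed
  also have "(\<integral>\<xi>. ?g \<xi> \<partial>P) = 1 + 4 * l\<^sup>2 * (\<integral>\<xi>. exp \<bar>X \<xi>\<bar> \<partial>P)"
    using X ie by (simp add: prob_space)
  also have "\<dots> \<le> 1 + 4 * l\<^sup>2 * B" using le by (intro add_left_mono mult_left_mono) auto
  also have "\<dots> \<le> exp (4 * B * l\<^sup>2)" using exp_ge_add_one_self[of "4 * B * l\<^sup>2"] by (simp add: mult_ac)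
  finally show ?thesis by (simp add: ennreal_leI)
qed

text \<open>The parameter \<open>l\<close> is left free so that it can be optimised once the
  deviation is fixed. Both tails come from the same moment bound, with the sign \<sigma> attached to
  \<open>l\<close>.\<close>

lemma Bernstein_two_sided:
  fixes X :: "'a \<Rightarrow> real"
  assumes P: "prob_space P" and I: "finite I"
    and X: "integrable P X" "(\<integral>\<xi>. X \<xi> \<partial>P) = 0"
    and B: "(\<integral>\<^sup>+\<xi>. ennreal (exp \<bar>X \<xi>\<bar>) \<partial>P) \<le> ennreal B" "0 \<le> B"
    and l: "0 \<le> l" "l \<le> 1 / 2"
  shows "measure (\<Pi>\<^sub>M k\<in>I. P)
      {\<omega> \<in> space (\<Pi>\<^sub>M k\<in>I. P). real (card I) * \<epsilon> \<le> \<bar>\<Sum>k\<in>I. X (\<omega> k)\<bar>}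
    \<le> 2 * exp (- (real (card I) * (l * \<epsilon> - 4 * B * l\<^sup>2)))"
proof -
  let ?M = "\<Pi>\<^sub>M k\<in>I. P" and ?n = "real (card I)"
  have Xm[measurable]: "X \<in> borel_measurable P" using X(1) by simp
  interpret M: prob_space ?M by (rule prob_space_PiM) (rule P)
  have S[measurable]: "(\<lambda>\<omega>. \<Sum>k\<in>I. X (\<omega> k)) \<in> borel_measurable ?M"
    by (intro borel_measurable_sum) measurable
  let ?T = "\<lambda>\<sigma>. {\<omega> \<in> space ?M. l * (?n * \<epsilon>) \<le> (\<Sum>k\<in>I. (\<sigma> * l) * X (\<omega> k))}"
  have T: "?T \<sigma> \<in> sets ?M" for \<sigma>
    unfolding sum_distrib_left[symmetric] by measurable
  have one: "measure ?M (?T \<sigma>) \<le> exp (- (?n * (l * \<epsilon> - 4 * B * l\<^sup>2)))"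
    if "\<sigma> = 1 \<or> \<sigma> = -1" for \<sigma> :: real
  proof -
    have "emeasure ?M (?T \<sigma>) \<le> ennreal (exp (- (l * (?n * \<epsilon>))) * exp (4 * B * (\<sigma> * l)\<^sup>2) ^ card I)"
      by (rule Chernoff_product[OF P I _ centered_mgf_bound[OF P X B]]) (use l that in auto)
    also have "exp (- (l * (?n * \<epsilon>))) * exp (4 * B * (\<sigma> * l)\<^sup>2) ^ card I
        = exp (- (?n * (l * \<epsilon> - 4 * B * l\<^sup>2)))"
      using that by (auto simp: exp_of_nat_mult[symmetric] exp_add[symmetric] algebra_simps)
    finally show ?thesis by (simp add: M.emeasure_eq_measure)
  qed
  have "{\<omega> \<in> space ?M. ?n * \<epsilon> \<le> \<bar>\<Sum>k\<in>I. X (\<omega> k)\<bar>} \<subseteq> ?T 1 \<union> ?T (-1)"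
  proof
    fix \<omega> assume "\<omega> \<in> {\<omega> \<in> space ?M. ?n * \<epsilon> \<le> \<bar>\<Sum>k\<in>I. X (\<omega> k)\<bar>}"
    then have w: "\<omega> \<in> space ?M" "?n * \<epsilon> \<le> \<bar>\<Sum>k\<in>I. X (\<omega> k)\<bar>" by auto
    have "l * (?n * \<epsilon>) \<le> l * (\<Sum>k\<in>I. X (\<omega> k)) \<or> l * (?n * \<epsilon>) \<le> l * - (\<Sum>k\<in>I. X (\<omega> k))"
      using w(2) l(1) mult_left_mono by (metis abs_le_iff abs_if)
    then show "\<omega> \<in> ?T 1 \<union> ?T (-1)" using w(1) by (auto simp: sum_distrib_left[symmetric] sum_negf)
  qed
  then have "measure ?M {\<omega> \<in> space ?M. ?n * \<epsilon> \<le> \<bar>\<Sum>k\<in>I. X (\<omega> k)\<bar>} \<le> measure ?M (?T 1 \<union> ?T (-1))"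
    using T by (intro M.finite_measure_mono) auto
  also have "\<dots> \<le> measure ?M (?T 1) + measure ?M (?T (-1))"
    using T by (intro measure_Un_le)
  also have "\<dots> \<le> 2 * exp (- (?n * (l * \<epsilon> - 4 * B * l\<^sup>2)))"
    using one[of 1] one[of "-1"] by simp
  finally show ?thesis .
qed

section \<open>From the exponential moment to the fluctuations of all entries\<close>

lemma (in prob_space) prob_avoid_finite_union:
  assumes T: "finite T" and A: "\<And>t. t \<in> T \<Longrightarrow> A t \<in> events" "\<And>t. t \<in> T \<Longrightarrow> prob (A t) \<le> p"
  shows "prob (space M - (\<Union>t\<in>T. A t)) \<ge> 1 - real (card T) * p"
proof -
  have "prob (\<Union>t\<in>T. A t) \<le> (\<Sum>t\<in>T. prob (A t))"
    using T A(1) by (intro finite_measure_subadditive_finite) auto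
  also have "\<dots> \<le> real (card T) * p" using A(2) by (rule sum_bounded_above)
  finally show ?thesis using T A(1) by (subst prob_compl) auto
qed

text \<open>Separates the fluctuation of the second moments from the error of the sample mean, which
  are then controlled by different entries of \<open>fluct\<close>.\<close>

lemma sum_lin_centered_power2:
  assumes N: "N \<ge> 1"
  shows "(\<Sum>k=1..N. (lin d v (centered d N \<omega> k))\<^sup>2) / real N
    = (\<Sum>k=1..N. (lin d v (\<omega> k))\<^sup>2) / real N - (lin d v (\<lambda>i. (\<Sum>k=1..N. \<omega> k i) / real N))\<^sup>2"
proof -
  define \<mu> where "\<mu> = (\<lambda>i. (\<Sum>k=1..N. \<omega> k i) / real N)"
  have s1: "(\<Sum>k=1..N. lin d v (\<omega> k)) = real N * lin d v \<mu>"
    using sum_lin_centered[OF N, of d v \<omega>]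
    unfolding lin_centered \<mu>_def[symmetric] by (simp add: sum_subtractf)
  have "(\<Sum>k=1..N. (lin d v (centered d N \<omega> k))\<^sup>2)
      = (\<Sum>k=1..N. (lin d v (\<omega> k))\<^sup>2 - 2 * lin d v \<mu> * lin d v (\<omega> k) + (lin d v \<mu>)\<^sup>2)"
    unfolding lin_centered \<mu>_def[symmetric]
    by (intro sum.cong) (simp_all add: power2_eq_square algebra_simps)
  also have "\<dots> = (\<Sum>k=1..N. (lin d v (\<omega> k))\<^sup>2)
      - 2 * lin d v \<mu> * (\<Sum>k=1..N. lin d v (\<omega> k)) + real N * (lin d v \<mu>)\<^sup>2"
    by (simp add: sum.distrib sum_subtractf sum_distrib_left)
  also have "\<dots> = (\<Sum>k=1..N. (lin d v (\<omega> k))\<^sup>2) - real N * (lin d v \<mu>)\<^sup>2"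
    unfolding s1 by (simp add: power2_eq_square)
  finally show ?thesis using N by (simp add: diff_divide_distrib \<mu>_def)
qed

text \<open>The form in which the moment assumption enters the concentration argument. Every product
  of two coordinates is at most \<open>sqn d \<xi>\<close> in absolute value, so this one moment
  controls all entries of the covariance.\<close>

definition square_exp_bound :: "nat \<Rightarrow> (nat \<Rightarrow> real) measure \<Rightarrow> real \<Rightarrow> bool" where
  "square_exp_bound d P B \<longleftrightarrow> 1 \<le> B \<and> (\<integral>\<^sup>+\<xi>. ennreal (exp (sqn d \<xi>)) \<partial>P) \<le> ennreal B"

text \<open>From r^2 \<le> 1 + r^\<gamma>, by cases r \<le> 1 and r > 1. The summand 1 costs the
  factor \<open>exp 1\<close>; 1 + \<tau> in place of \<tau> keeps the bound at least 1.\<close>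

lemma square_exp_bound_of_powr:
  assumes \<gamma>: "\<gamma> > 2" and \<tau>: "\<tau> > 0" and P: "sets P = sets (Rd d)"
    and E: "(\<integral>\<^sup>+ \<xi>. ennreal (exp (L2_set \<xi> {..<d} powr \<gamma>)) \<partial>P) \<le> ennreal \<tau>"
  shows "square_exp_bound d P (exp 1 * (1 + \<tau>))"
proof -
  have [measurable_cong]: "sets P = sets (Rd d)" by fact
  have pt: "exp (sqn d \<xi>) \<le> exp 1 * exp (L2_set \<xi> {..<d} powr \<gamma>)" for \<xi>
  proof -
    let ?r = "L2_set \<xi> {..<d}"
    have r: "0 \<le> ?r" by (rule L2_set_nonneg)
    have "?r\<^sup>2 \<le> 1 + ?r powr \<gamma>"
    proof (cases "?r \<le> 1")
      case True
      then have "?r\<^sup>2 \<le> 1" using r by (simp add: power_le_one)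
      then show ?thesis using powr_ge_zero[of ?r \<gamma>] by linarith
    next
      case False
      then have "?r powr 2 \<le> ?r powr \<gamma>" using \<gamma> by (intro powr_mono) auto
      then show ?thesis using False r by simp
    qed
    then show ?thesis by (simp add: L2_set_power2 exp_add[symmetric])
  qed
  have "(\<lambda>\<xi>. L2_set \<xi> {..<d}) = (\<lambda>\<xi>. sqrt (sqn d \<xi>))" by (simp add: L2_set_def sqn_def)
  then have [measurable]: "(\<lambda>\<xi>. L2_set \<xi> {..<d}) \<in> borel_measurable P" by simp
  have "(\<integral>\<^sup>+\<xi>. ennreal (exp (sqn d \<xi>)) \<partial>P)
      \<le> (\<integral>\<^sup>+\<xi>. ennreal (exp 1) * ennreal (exp (L2_set \<xi> {..<d} powr \<gamma>)) \<partial>P)"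
    by (intro nn_integral_mono) (simp add: ennreal_mult[symmetric] pt)
  also have "\<dots> = ennreal (exp 1) * (\<integral>\<^sup>+\<xi>. ennreal (exp (L2_set \<xi> {..<d} powr \<gamma>)) \<partial>P)"
    by (rule nn_integral_cmult) simp
  also have "\<dots> \<le> ennreal (exp 1) * ennreal \<tau>" by (intro mult_left_mono E) simp
  also have "\<dots> \<le> ennreal (exp 1 * (1 + \<tau>))"
    using \<tau> by (simp add: ennreal_mult[symmetric])
  moreover have "1 * 1 \<le> exp 1 * (1 + \<tau>)" using \<tau> by (intro mult_mono) auto
  ultimately show ?thesis by (simp add: square_exp_bound_def)
qed

context
  fixes d :: nat and P :: "(nat \<Rightarrow> real) measure" and B0 :: real
  assumes P: "P \<in> zero_mean_dists d" and EB: "square_exp_bound d P B0"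
begin

interpretation prob_space P using P by (simp add: zero_mean_dists_def)

lemma sets_P [measurable_cong]: "sets P = sets (Rd d)"
  using P by (simp add: zero_mean_dists_def)

lemma B0_ge_1: "1 \<le> B0"
  using EB by (simp add: square_exp_bound_def)

lemma integrable_exp_sqn: "integrable P (\<lambda>\<xi>. exp (sqn d \<xi>))"
  using EB by (intro integrableI_bounded) (auto simp: square_exp_bound_def order_le_less_trans)

lemma integral_exp_sqn_le: "(\<integral>\<xi>. exp (sqn d \<xi>) \<partial>P) \<le> B0"
  using EB nn_integral_eq_integral[OF integrable_exp_sqn] B0_ge_1 by (simp add: square_exp_bound_def ennreal_le_iff)

lemma abs_prod_le_sqn:
  assumes "i < d" "j < d"
  shows "\<bar>\<xi> i * \<xi> j\<bar> \<le> sqn d (\<xi> :: nat \<Rightarrow> real)"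
proof -
  have le: "(\<xi> i)\<^sup>2 \<le> sqn d \<xi>" if "i < d" for i
    unfolding sqn_def using that by (intro member_le_sum) auto
  have "0 \<le> (\<bar>\<xi> i\<bar> - \<bar>\<xi> j\<bar>)\<^sup>2" by simp
  then have "2 * \<bar>\<xi> i * \<xi> j\<bar> \<le> (\<xi> i)\<^sup>2 + (\<xi> j)\<^sup>2" by (simp add: power2_diff abs_mult)
  then show ?thesis using le[OF assms(1)] le[OF assms(2)] by linarith
qed

lemma sqn_le_exp: "sqn d \<xi> \<le> exp (sqn d \<xi>)"
  using exp_ge_add_one_self[of "sqn d \<xi>"] by linarith

lemma integrable_sqn: "integrable P (sqn d)"
  by (rule Bochner_Integration.integrable_bound[OF integrable_exp_sqn])
    (simp_all add: sqn_le_exp)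

lemma integral_sqn_le: "(\<integral>\<xi>. sqn d \<xi> \<partial>P) \<le> B0"
  using integral_mono[OF integrable_sqn integrable_exp_sqn sqn_le_exp] integral_exp_sqn_le by linarith

lemma integrable_prod:
  assumes "i < d" "j < d"
  shows "integrable P (\<lambda>\<xi>. \<xi> i * \<xi> j)"
  by (rule Bochner_Integration.integrable_bound[OF integrable_sqn])
    (use assms abs_prod_le_sqn[OF assms] in auto)

lemma abs_integral_prod_le:
  assumes "i < d" "j < d"
  shows "\<bar>\<integral>\<xi>. \<xi> i * \<xi> j \<partial>P\<bar> \<le> B0"
proof -
  have "\<bar>\<integral>\<xi>. \<xi> i * \<xi> j \<partial>P\<bar> \<le> (\<integral>\<xi>. \<bar>\<xi> i * \<xi> j\<bar> \<partial>P)" by (rule integral_abs_bound)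
  also have "\<dots> \<le> (\<integral>\<xi>. sqn d \<xi> \<partial>P)"
    by (intro integral_mono integrable_abs integrable_prod assms integrable_sqn abs_prod_le_sqn)
  finally show ?thesis using integral_sqn_le by linarith
qed

lemma integral_lin_power2_le: "(\<integral>\<xi>. (lin d v \<xi>)\<^sup>2 \<partial>P) \<le> B0 * sqn d v"
proof -
  have "(\<integral>\<xi>. (lin d v \<xi>)\<^sup>2 \<partial>P) \<le> (\<integral>\<xi>. sqn d v * sqn d \<xi> \<partial>P)"
    using P integrable_prod
    by (intro integral_mono cov_mat_quadratic_form(2) lin_power2_le integrable_mult_right integrable_sqn)
      (auto simp: zero_mean_dists_def)
  also have "\<dots> \<le> sqn d v * B0" using integral_sqn_le by (simp add: mult_left_mono)
  finally show ?thesis by (simp add: mult.commute)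
qed

text \<open>The index \<open>(d, j)\<close> encodes the coordinate \<open>j\<close> itself, so that one union bound controls the
  second moments and the sample mean together.\<close>

definition fluct :: "nat \<times> nat \<Rightarrow> (nat \<Rightarrow> real) \<Rightarrow> real" where
  "fluct = (\<lambda>(i, j) \<xi>. if i < d then \<xi> i * \<xi> j - (\<integral>\<eta>. \<eta> i * \<eta> j \<partial>P) else \<xi> j)"

text \<open>Both kinds of fluctuation are at most \<open>sqn d \<xi> + B0\<close> in absolute value,
  which gives them a common exponential moment bound.\<close>

lemma fluct_props:
  assumes "t \<in> {..d} \<times> {..<d}"
  shows "integrable P (fluct t)" "(\<integral>\<xi>. fluct t \<xi> \<partial>P) = 0"
    and "(\<integral>\<^sup>+\<xi>. ennreal (exp \<bar>fluct t \<xi>\<bar>) \<partial>P) \<le> ennreal (exp B0 * B0)"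
proof -
  obtain i j where t: "t = (i, j)" "j < d" using assms by auto
  have 1: "integrable P (\<lambda>\<xi>. \<xi> j)" "(\<integral>\<xi>. \<xi> j \<partial>P) = 0"
    using P t by (auto simp: zero_mean_dists_def)
  show int: "integrable P (fluct t)"
    using 1 t integrable_prod by (cases "i < d") (auto simp: fluct_def)
  show "(\<integral>\<xi>. fluct t \<xi> \<partial>P) = 0"
    using 1 t integrable_prod by (cases "i < d") (auto simp: fluct_def prob_space)
  have pt: "exp \<bar>fluct t \<xi>\<bar> \<le> exp B0 * exp (sqn d \<xi>)" for \<xi>
  proof (cases "i < d")
    case True
    then have "\<bar>fluct t \<xi>\<bar> \<le> \<bar>\<xi> i * \<xi> j\<bar> + \<bar>\<integral>\<eta>. \<eta> i * \<eta> j \<partial>P\<bar>"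
      using t by (simp add: fluct_def)
    then show ?thesis
      using abs_prod_le_sqn[OF True t(2), of \<xi>] abs_integral_prod_le[OF True t(2)]
      by (simp add: exp_add[symmetric])
  next
    case False
    have "0 \<le> (\<bar>\<xi> j\<bar> - 1)\<^sup>2" by simp
    then have "2 * \<bar>\<xi> j\<bar> \<le> (\<xi> j)\<^sup>2 + 1" by (simp add: power2_diff)
    moreover have "\<bar>\<xi> j * \<xi> j\<bar> = (\<xi> j)\<^sup>2" by (simp add: power2_eq_square)
    ultimately have "2 * \<bar>\<xi> j\<bar> \<le> \<bar>\<xi> j * \<xi> j\<bar> + 1" by simp
    then show ?thesis
      using False t abs_prod_le_sqn[OF t(2) t(2), of \<xi>] B0_ge_1
      by (simp add: exp_add[symmetric] fluct_def)
  qed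
  have "(\<integral>\<^sup>+\<xi>. ennreal (exp \<bar>fluct t \<xi>\<bar>) \<partial>P)
      \<le> (\<integral>\<^sup>+\<xi>. ennreal (exp B0) * ennreal (exp (sqn d \<xi>)) \<partial>P)"
    by (intro nn_integral_mono) (simp add: ennreal_mult[symmetric] pt)
  also have "\<dots> = ennreal (exp B0) * (\<integral>\<^sup>+\<xi>. ennreal (exp (sqn d \<xi>)) \<partial>P)"
    by (rule nn_integral_cmult) simp
  also have "\<dots> \<le> ennreal (exp B0) * ennreal B0"
    using EB by (intro mult_left_mono) (auto simp: square_exp_bound_def)
  finally show "(\<integral>\<^sup>+\<xi>. ennreal (exp \<bar>fluct t \<xi>\<bar>) \<partial>P) \<le> ennreal (exp B0 * B0)"
    using B0_ge_1 by (simp add: ennreal_mult)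
qed

lemma fluct_event:
  assumes l: "0 \<le> l" "l \<le> 1 / 2"
  shows "\<exists>E \<in> sets (\<Pi>\<^sub>M k\<in>{1..N}. P).
    measure (\<Pi>\<^sub>M k\<in>{1..N}. P) E
      \<ge> 1 - real ((d + 1) * d) * (2 * exp (- (real N * (l * \<epsilon> - 4 * (exp B0 * B0) * l\<^sup>2)))) \<and>
    (\<forall>\<omega>\<in>E. \<forall>t\<in>{..d} \<times> {..<d}. \<bar>\<Sum>k=1..N. fluct t (\<omega> k)\<bar> \<le> real N * \<epsilon>)"
proof -
  let ?M = "\<Pi>\<^sub>M k\<in>{1..N}. P" and ?T = "{..d} \<times> {..<d}"
  let ?A = "\<lambda>t. {\<omega> \<in> space ?M. real (card {1..N}) * \<epsilon> \<le> \<bar>\<Sum>k\<in>{1..N}. fluct t (\<omega> k)\<bar>}"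
  interpret M: prob_space ?M by (rule prob_space_PiM) (rule prob_space_axioms)
  have A: "?A t \<in> sets ?M" if "t \<in> ?T" for t
  proof -
    have [measurable]: "fluct t \<in> borel_measurable P" using fluct_props(1)[OF that] by simp
    have "(\<lambda>\<omega>. \<Sum>k\<in>{1..N}. fluct t (\<omega> k)) \<in> borel_measurable ?M"
      by (intro borel_measurable_sum) measurable
    then show ?thesis by measurable
  qed
  have p: "measure ?M (?A t) \<le> 2 * exp (- (real N * (l * \<epsilon> - 4 * (exp B0 * B0) * l\<^sup>2)))"
    if "t \<in> ?T" for t
    using Bernstein_two_sided[OF prob_space_axioms _ fluct_props[OF that], of "{1..N}" l \<epsilon>] l B0_ge_1
    by simp
  have "1 - real (card ?T) * (2 * exp (- (real N * (l * \<epsilon> - 4 * (exp B0 * B0) * l\<^sup>2))))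
      \<le> measure ?M (space ?M - (\<Union>t\<in>?T. ?A t))"
    by (rule M.prob_avoid_finite_union[OF _ A p]) auto
  moreover have "card ?T = (d + 1) * d" by (simp add: card_cartesian_product)
  moreover have "space ?M - (\<Union>t\<in>?T. ?A t) \<in> sets ?M" using A by (intro sets.Diff sets.finite_UN) auto
  moreover have "\<bar>\<Sum>k=1..N. fluct t (\<omega> k)\<bar> \<le> real N * \<epsilon>"
    if "\<omega> \<in> space ?M - (\<Union>t\<in>?T. ?A t)" "t \<in> ?T" for \<omega> t
  proof -
    have "\<omega> \<notin> ?A t" "\<omega> \<in> space ?M" using that by blast+
    then show ?thesis by simp
  qed
  ultimately show ?thesis by (intro bexI[of _ "space ?M - (\<Union>t\<in>?T. ?A t)"]) auto
qed

text \<open>Chernoff's bound with parameter 1 and no centering. It is informative only for s above N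
  ln \<open>B0\<close>, which is the situation with few samples.\<close>

lemma sqn_event:
  shows "\<exists>E \<in> sets (\<Pi>\<^sub>M k\<in>{1..N}. P).
    measure (\<Pi>\<^sub>M k\<in>{1..N}. P) E \<ge> 1 - exp (- s) * B0 ^ N \<and>
    (\<forall>\<omega>\<in>E. (\<Sum>k=1..N. sqn d (\<omega> k)) \<le> s)"
proof -
  let ?M = "\<Pi>\<^sub>M k\<in>{1..N}. P"
  let ?A = "{\<omega> \<in> space ?M. s \<le> (\<Sum>k\<in>{1..N}. sqn d (\<omega> k))}"
  interpret M: prob_space ?M by (rule prob_space_PiM) (rule prob_space_axioms)
  have m[measurable]: "sqn d \<in> borel_measurable P" using integrable_sqn by simp
  have "(\<lambda>\<omega>. \<Sum>k\<in>{1..N}. sqn d (\<omega> k)) \<in> borel_measurable ?M"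
    by (intro borel_measurable_sum) measurable
  then have A: "?A \<in> sets ?M" by measurable
  have "emeasure ?M ?A \<le> ennreal (exp (- s) * B0 ^ card {1..N})"
    using EB by (intro Chernoff_product[OF prob_space_axioms _ m]) (auto simp: square_exp_bound_def)
  then have "measure ?M ?A \<le> exp (- s) * B0 ^ N"
    using B0_ge_1 unfolding M.emeasure_eq_measure by (subst (asm) ennreal_le_iff) auto
  then have "1 - exp (- s) * B0 ^ N \<le> measure ?M (space ?M - ?A)"
    using M.prob_compl[OF A] by simp
  then show ?thesis using A by (intro bexI[of _ "space ?M - ?A"]) auto
qed

text \<open>Entrywise errors of size \<epsilon> change the quadratic form by at most \<epsilon>
  times the squared sum of |v i|, and Cauchy-Schwarz bounds that square by d \<open>sqn d v\<close>.
  Centering only lowers the empirical moment, so the squared sample mean costs an additional term in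
  the first estimate only.\<close>

lemma second_moments_close:
  assumes N: "N \<ge> 1" and \<epsilon>: "\<epsilon> \<ge> 0"
    and w: "\<And>t. t \<in> {..d} \<times> {..<d} \<Longrightarrow> \<bar>\<Sum>k=1..N. fluct t (\<omega> k)\<bar> \<le> real N * \<epsilon>"
  shows "(\<integral>\<xi>. (lin d v \<xi>)\<^sup>2 \<partial>P)
      \<le> (\<Sum>k=1..N. (lin d v (centered d N \<omega> k))\<^sup>2) / real N + real d * (\<epsilon> + \<epsilon>\<^sup>2) * sqn d v"
    and "(\<Sum>k=1..N. (lin d v (centered d N \<omega> k))\<^sup>2) / real N
      \<le> (\<integral>\<xi>. (lin d v \<xi>)\<^sup>2 \<partial>P) + real d * \<epsilon> * sqn d v"
proof -
  let ?I = "\<lambda>i j. \<integral>\<eta>. \<eta> i * \<eta> j \<partial>P"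
  define \<mu> where "\<mu> = (\<lambda>i. (\<Sum>k=1..N. \<omega> k i) / real N)"
  have N0: "real N > 0" using N by simp
  have sq: "(lin d v \<xi>)\<^sup>2 = (\<Sum>i<d. \<Sum>j<d. v i * v j * (\<xi> i * \<xi> j))" for \<xi>
    by (simp add: lin_def power2_eq_square sum_product mult_ac)
  have "vec d v \<bullet> (cov_mat d P *\<^sub>v vec d v) = (\<integral>\<xi>. (lin d v \<xi>)\<^sup>2 \<partial>P)"
    using P integrable_prod by (intro cov_mat_quadratic_form(1)) (auto simp: zero_mean_dists_def)
  then have m: "(\<integral>\<xi>. (lin d v \<xi>)\<^sup>2 \<partial>P) = (\<Sum>i<d. \<Sum>j<d. v i * v j * ?I i j)"
    using P by (auto simp: scalar_prod_def cov_mat_def lessThan_atLeast0 sum_distrib_left mult_ac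
      zero_mean_dists_def intro!: sum.cong)
  note c2 = sum_lin_centered_power2[OF N, of d v \<omega>, folded \<mu>_def]
  \<comment> \<open>The index \<open>(d, j)\<close> of \<open>fluct\<close> is the one that stands
    for the coordinate j.\<close>
  have \<mu>: "\<bar>\<mu> j\<bar> \<le> \<epsilon>" if "j < d" for j
    using w[of "(d, j)"] that N0 by (simp add: fluct_def \<mu>_def pos_divide_le_eq mult.commute)
  have "sqn d \<mu> \<le> (\<Sum>i<d. \<epsilon>\<^sup>2)"
    unfolding sqn_def using \<mu> by (intro sum_mono) (metis abs_le_square_iff abs_of_nonneg \<epsilon> lessThan_iff)
  then have "sqn d v * sqn d \<mu> \<le> sqn d v * (real d * \<epsilon>\<^sup>2)"
    by (intro mult_left_mono) simp_all
  with lin_power2_le[of d v \<mu>] have l\<mu>: "(lin d v \<mu>)\<^sup>2 \<le> real d * \<epsilon>\<^sup>2 * sqn d v"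
    by (simp add: mult_ac)
  have "(\<Sum>k=1..N. (lin d v (\<omega> k))\<^sup>2) / real N - (\<integral>\<xi>. (lin d v \<xi>)\<^sup>2 \<partial>P)
      = (\<Sum>i<d. \<Sum>j<d. v i * v j * ((\<Sum>k=1..N. fluct (i, j) (\<omega> k)) / real N))"
  proof -
    have f: "(\<Sum>k=1..N. fluct (i, j) (\<omega> k)) / real N = (\<Sum>k=1..N. \<omega> k i * \<omega> k j) / real N - ?I i j"
      if "i < d" for i j
      using that N0 by (simp add: fluct_def sum_subtractf diff_divide_distrib)
    have "(\<Sum>k=1..N. (lin d v (\<omega> k))\<^sup>2)
        = (\<Sum>i<d. \<Sum>k=1..N. \<Sum>j<d. v i * v j * (\<omega> k i * \<omega> k j))"
      unfolding sq by (rule sum.swap)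
    also have "\<dots> = (\<Sum>i<d. \<Sum>j<d. v i * v j * (\<Sum>k=1..N. \<omega> k i * \<omega> k j))"
      unfolding sum_distrib_left by (intro sum.cong[OF refl], rule sum.swap)
    finally have "(\<Sum>k=1..N. (lin d v (\<omega> k))\<^sup>2) / real N
        = (\<Sum>i<d. \<Sum>j<d. v i * v j * ((\<Sum>k=1..N. \<omega> k i * \<omega> k j) / real N))"
      by (simp only: sum_divide_distrib[where A = "{..<d}"] times_divide_eq_right)
    then show ?thesis
      unfolding m
      by (simp only: sum_subtractf[symmetric] right_diff_distrib[symmetric])
        (intro sum.cong refl, simp only: f lessThan_iff)
  qed
  also have "\<bar>\<dots>\<bar> \<le> (\<Sum>i<d. \<Sum>j<d. \<bar>v i\<bar> * \<bar>v j\<bar> * \<epsilon>)"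
  proof (intro order_trans[OF sum_abs] sum_mono)
    fix i j assume ij: "i \<in> {..<d}" "j \<in> {..<d}"
    have "\<bar>(\<Sum>k=1..N. fluct (i, j) (\<omega> k)) / real N\<bar> \<le> \<epsilon>"
      using w[of "(i, j)"] ij N0 by (simp add: pos_divide_le_eq mult.commute)
    then show "\<bar>v i * v j * ((\<Sum>k=1..N. fluct (i, j) (\<omega> k)) / real N)\<bar> \<le> \<bar>v i\<bar> * \<bar>v j\<bar> * \<epsilon>"
      unfolding abs_mult by (intro mult_left_mono) auto
  qed
  also have "\<dots> = (\<Sum>i<d. \<bar>v i\<bar> * 1)\<^sup>2 * \<epsilon>"
    unfolding power2_eq_square sum_product by (simp add: sum_distrib_right)
  also have "\<dots> \<le> ((\<Sum>i<d. \<bar>v i\<bar>\<^sup>2) * (\<Sum>i<d. 1\<^sup>2)) * \<epsilon>"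
    by (intro mult_right_mono Cauchy_Schwarz_ineq_sum \<epsilon>)
  also have "\<dots> = real d * \<epsilon> * sqn d v" by (simp add: sqn_def)
  finally have dev: "\<bar>(\<Sum>k=1..N. (lin d v (\<omega> k))\<^sup>2) / real N - (\<integral>\<xi>. (lin d v \<xi>)\<^sup>2 \<partial>P)\<bar>
    \<le> real d * \<epsilon> * sqn d v" .
  show "(\<integral>\<xi>. (lin d v \<xi>)\<^sup>2 \<partial>P)
      \<le> (\<Sum>k=1..N. (lin d v (centered d N \<omega> k))\<^sup>2) / real N + real d * (\<epsilon> + \<epsilon>\<^sup>2) * sqn d v"
    using dev l\<mu> unfolding c2 distrib_left distrib_right by linarith
  show "(\<Sum>k=1..N. (lin d v (centered d N \<omega> k))\<^sup>2) / real N
      \<le> (\<integral>\<xi>. (lin d v \<xi>)\<^sup>2 \<partial>P) + real d * \<epsilon> * sqn d v"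
    using dev zero_le_power2[of "lin d v \<mu>"] unfolding c2 by linarith
qed

end

lemma centered_second_moment_le:
  assumes N: "N \<ge> 1"
  shows "(\<Sum>k=1..N. (lin d v (centered d N \<omega> k))\<^sup>2) / real N \<le> (\<Sum>k=1..N. sqn d (\<omega> k)) / real N * sqn d v"
proof -
  have "(\<Sum>k=1..N. (lin d v (centered d N \<omega> k))\<^sup>2) / real N \<le> (\<Sum>k=1..N. (lin d v (\<omega> k))\<^sup>2) / real N"
    unfolding sum_lin_centered_power2[OF N] by simp
  also have "\<dots> \<le> (\<Sum>k=1..N. sqn d v * sqn d (\<omega> k)) / real N"
    by (intro divide_right_mono sum_mono lin_power2_le) simp
  finally show ?thesis
    by (simp add: sum_distrib_left[symmetric] mult_ac)
qed

subsection \<open>The performance guarantee\<close>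

lemma J_eq_sum:
  assumes "\<And>\<xi>. lq_cost S K \<xi> = (\<Sum>a<m. (lin d (l a) \<xi>)\<^sup>2)" and "sets Q = sets (Rd d)"
  shows "J S K Q = (\<Sum>a<m::nat. \<integral>\<^sup>+\<xi>. ennreal ((lin d (l a) \<xi>)\<^sup>2) \<partial>Q)"
proof -
  have "lin d v \<in> borel_measurable Q" for v
    by (subst measurable_cong_sets[OF assms(2) refl]) (rule lin_measurable)
  then have m: "(\<lambda>\<xi>. ennreal ((lin d v \<xi>)\<^sup>2)) \<in> borel_measurable Q" for v by simp
  have "J S K Q = (\<integral>\<^sup>+\<xi>. (\<Sum>a<m. ennreal ((lin d (l a) \<xi>)\<^sup>2)) \<partial>Q)"
    unfolding J_def assms(1) by (simp add: sum_ennreal)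
  also have "\<dots> = (\<Sum>a<m. \<integral>\<^sup>+\<xi>. ennreal ((lin d (l a) \<xi>)\<^sup>2) \<partial>Q)"
    by (rule nn_integral_sum) (rule m)
  finally show ?thesis .
qed

lemma is_arg_min_le:
  fixes f :: "'a \<Rightarrow> 'b :: linorder"
  assumes "is_arg_min f C x" "C y"
  shows "f x \<le> f y"
  using assms unfolding is_arg_min_def by (meson not_le)

text \<open>The deterministic half: the samples are fixed and their closeness to \<open>P\<close> is
  expressed by \<open>low\<close> and \<open>up\<close>. The slack in \<open>low\<close> is exactly
  what the inflated law gains in each direction, while \<open>up\<close> may lose as much as
  \<open>\<rho>\<^sup>2\<close>.\<close>

lemma dr_cost_bound:
  assumes S: "lq_problem S" "noise_dim S = d" and d: "d > 0"
    and P: "P \<in> zero_mean_dists d" and pd: "pd_mat d (cov_mat d P)"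
    and int: "\<And>i j. i < d \<Longrightarrow> j < d \<Longrightarrow> integrable P (\<lambda>\<xi>. \<xi> i * \<xi> j)"
    and N: "N \<ge> 1" and \<rho>: "\<rho> > 0"
    and low: "\<And>v. (\<integral>\<xi>. (lin d v \<xi>)\<^sup>2 \<partial>P)
      \<le> (\<Sum>k=1..N. (lin d v (centered d N \<omega> k))\<^sup>2) / real N + \<rho>\<^sup>2 / real d * sqn d v"
    and up: "\<And>v. (\<Sum>k=1..N. (lin d v (centered d N \<omega> k))\<^sup>2) / real N
      \<le> (\<integral>\<xi>. (lin d v \<xi>)\<^sup>2 \<partial>P) + \<rho>\<^sup>2 * sqn d v"
    and K: "K \<in> causal S" and Kdr: "Kdr \<in> dr_controllers S \<rho> (centered_empirical d N \<omega>)"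
    and \<alpha>: "\<alpha> = lambda_min (cov_mat d P) powr (- 1 / 2)"
    and \<beta>: "\<beta> = lambda_max (cov_mat d (centered_empirical d N \<omega>)) powr (1 / 2)"
  shows "J S Kdr P \<le> J S K P * ennreal (1 + 2 * (\<rho> * (2 * \<beta> + \<rho>)) * \<alpha>\<^sup>2)"
proof -
  let ?Ph = "centered_empirical d N \<omega>"
  define m where "m v = (\<integral>\<xi>. (lin d v \<xi>)\<^sup>2 \<partial>P)" for v
  define mh where "mh v = (\<Sum>k=1..N. (lin d v (centered d N \<omega> k))\<^sup>2) / real N" for v
  have setsP: "sets P = sets (Rd d)" using P by (simp add: zero_mean_dists_def)
  have zm: "\<And>i. i < d \<Longrightarrow> (\<integral>\<xi>. \<xi> i \<partial>P) = 0" using P by (simp add: zero_mean_dists_def)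
  have m0: "0 \<le> m v" for v unfolding m_def by simp
  have mh0: "0 \<le> mh v" for v unfolding mh_def by (simp add: sum_nonneg)
  have qf: "vec d v \<bullet> (cov_mat d P *\<^sub>v vec d v) = m v" for v
    unfolding m_def by (rule cov_mat_quadratic_form(1)) (use zm int in auto)
  have qi: "integrable P (\<lambda>\<xi>. (lin d v \<xi>)\<^sup>2)" for v
    by (rule cov_mat_quadratic_form(2)) (use zm int in auto)
  have nnP: "(\<integral>\<^sup>+\<xi>. ennreal ((lin d v \<xi>)\<^sup>2) \<partial>P) = ennreal (m v)" for v
    unfolding m_def using nn_integral_eq_integral[OF qi] by simp
  have nnPh: "(\<integral>\<^sup>+\<xi>. ennreal ((lin d v \<xi>)\<^sup>2) \<partial>?Ph) = ennreal (mh v)" for v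
    unfolding mh_def by (rule centered_second_moment(1)[OF N])
  note cov = cov_mat_carrier[of d] cov_mat_symmetric[of d]
  let ?lmin = "lambda_min (cov_mat d P)" and ?lmax = "lambda_max (cov_mat d ?Ph)"
  have lmin: "?lmin > 0"
  proof -
    obtain v where v: "v \<in> carrier_vec d" "v \<noteq> 0\<^sub>v d" "0 < v \<bullet> v"
        "v \<bullet> (cov_mat d P *\<^sub>v v) = ?lmin * (v \<bullet> v)"
      using spectrum_Rayleigh[OF cov(1) lambda_min_le_Rayleigh(1)[OF cov d]] by blast
    have "0 < ?lmin * (v \<bullet> v)" using pd v unfolding pd_mat_def by metis
    then show ?thesis using v(3) by (simp add: zero_less_mult_iff)
  qed
  have lower: "?lmin * sqn d v \<le> m v" for v
    using lambda_min_le_Rayleigh(2)[OF cov d, of "vec d v" P]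
    by (simp add: vec_scalar_prod_self qf)
  have lmax: "?lmax \<ge> 0"
  proof -
    obtain v where v: "v \<in> carrier_vec d" "0 < v \<bullet> v"
        "v \<bullet> (cov_mat d ?Ph *\<^sub>v v) = ?lmax * (v \<bullet> v)"
      using spectrum_Rayleigh[OF cov(1) Rayleigh_le_lambda_max(1)[OF cov d]] by blast
    have "v = vec d (\<lambda>i. v $ i)" using v(1) by auto
    then have "v \<bullet> (cov_mat d ?Ph *\<^sub>v v) = mh (\<lambda>i. v $ i)"
      unfolding mh_def cov_mat_centered_empirical[OF N, symmetric] by simp
    then have "0 \<le> ?lmax * (v \<bullet> v)" using v(3) mh0 by metis
    then show ?thesis using v(2) by (simp add: zero_le_mult_iff)
  qed
  have \<beta>2: "\<beta>\<^sup>2 = ?lmax" "\<beta> \<ge> 0" using lmax by (simp_all add: \<beta> powr_half_sqrt)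
  have upper: "mh v \<le> \<beta>\<^sup>2 * sqn d v" for v
    using Rayleigh_le_lambda_max(2)[OF cov d, of "vec d v" ?Ph]
    by (simp add: vec_scalar_prod_self mh_def \<beta>2 cov_mat_centered_empirical[OF N])
  have \<alpha>2: "\<alpha>\<^sup>2 = 1 / ?lmin"
    unfolding \<alpha> using lmin by (simp add: powr_power powr_neg_one)
  define R where "R = \<rho> * (2 * \<beta> + \<rho>)"
  have R: "\<rho>\<^sup>2 \<le> R" using \<rho> \<beta>2 by (simp add: R_def power2_eq_square distrib_left)
  have R0: "R \<ge> 0" using R zero_le_power2[of \<rho>] by linarith
  \<comment> \<open>This is the origin of the factor 2: one \<open>R\<close> comes from the ball,
    the other from passing from the empirical to the true moment by \<open>up\<close> and
    \<open>\<rho>\<^sup>2 \<le> R\<close>. Then \<open>lower\<close> turns \<open>sqn d v\<close>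
    into \<open>m v * \<alpha>\<^sup>2\<close>.\<close>
  have key: "mh v + R * sqn d v \<le> m v * (1 + 2 * R * \<alpha>\<^sup>2)" for v
  proof -
    have "mh v + R * sqn d v \<le> m v + \<rho>\<^sup>2 * sqn d v + R * sqn d v"
      using up[of v] by (simp add: m_def mh_def)
    also have "\<dots> \<le> m v + R * sqn d v + R * sqn d v"
      using R by (intro add_mono mult_right_mono) auto
    also have "R * sqn d v \<le> R * (m v * \<alpha>\<^sup>2)"
      using lower[of v] lmin R0 by (intro mult_left_mono) (simp_all add: \<alpha>2 field_simps)
    finally show ?thesis by (simp add: algebra_simps)
  qed
  have dr: "is_arg_min (\<lambda>K. SUP Q \<in> wasserstein_ball d \<rho> ?Ph. J S K Q) (\<lambda>K. K \<in> causal S) Kdr"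
    using Kdr S(2) by (simp add: dr_controllers_def)
  then have Kdrc: "Kdr \<in> causal S" by (simp add: is_arg_min_def)
  obtain l and n :: nat where l: "\<And>\<xi>. lq_cost S Kdr \<xi> = (\<Sum>a<n. (lin d (l a) \<xi>)\<^sup>2)"
    using lq_cost_sum_squares[OF S(1) Kdrc] unfolding S(2) lin_def by blast
  obtain l' and n' :: nat where l': "\<And>\<xi>. lq_cost S K \<xi> = (\<Sum>a<n'. (lin d (l' a) \<xi>)\<^sup>2)"
    using lq_cost_sum_squares[OF S(1) K] unfolding S(2) lin_def by blast
  let ?Q = "inflated_empirical d N \<rho> \<omega>"
  have ball: "?Q \<in> wasserstein_ball d \<rho> ?Ph"
    using \<rho> by (intro inflated_in_ball[OF N d]) simp
  have setsQi: "sets ?Q = sets (Rd d)" by (simp add: inflated_empirical_def)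
  have "J S Kdr P \<le> J S Kdr ?Q"
    unfolding J_eq_sum[OF l setsP]
    using low unfolding J_eq_sum[OF l setsQi] inflated_second_moment[OF N d] nnP m_def
    by (intro sum_mono ennreal_leI)
  also have "\<dots> \<le> (SUP Q \<in> wasserstein_ball d \<rho> ?Ph. J S Kdr Q)" using ball by (rule SUP_upper)
  also have "\<dots> \<le> (SUP Q \<in> wasserstein_ball d \<rho> ?Ph. J S K Q)" by (rule is_arg_min_le[OF dr K])
  also have "\<dots> \<le> J S K P * ennreal (1 + 2 * R * \<alpha>\<^sup>2)"
  proof (rule SUP_least)
    fix Q assume Q: "Q \<in> wasserstein_ball d \<rho> ?Ph"
    then have setsQ: "sets Q = sets (Rd d)" by (simp add: wasserstein_ball_def zero_mean_dists_def)
    have "J S K Q \<le> (\<Sum>a<n'. ennreal (m (l' a)) * ennreal (1 + 2 * R * \<alpha>\<^sup>2))"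
      unfolding J_eq_sum[OF l' setsQ]
    proof (rule sum_mono)
      fix a
      have "(\<integral>\<^sup>+\<xi>. ennreal ((lin d (l' a) \<xi>)\<^sup>2) \<partial>Q) \<le> ennreal (mh (l' a) + R * sqn d (l' a))"
        unfolding R_def by (rule wasserstein_ball_second_moment[OF Q \<rho> \<beta>2(2) nnPh mh0 upper])
      also have "\<dots> \<le> ennreal (m (l' a) * (1 + 2 * R * \<alpha>\<^sup>2))" by (intro ennreal_leI key)
      also have "\<dots> = ennreal (m (l' a)) * ennreal (1 + 2 * R * \<alpha>\<^sup>2)"
        using R0 m0 by (intro ennreal_mult) auto
      finally show "(\<integral>\<^sup>+\<xi>. ennreal ((lin d (l' a) \<xi>)\<^sup>2) \<partial>Q)
        \<le> ennreal (m (l' a)) * ennreal (1 + 2 * R * \<alpha>\<^sup>2)" .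
    qed
    also have "\<dots> = J S K P * ennreal (1 + 2 * R * \<alpha>\<^sup>2)"
      unfolding J_eq_sum[OF l' setsP] nnP by (simp only: sum_distrib_right)
    finally show "J S K Q \<le> J S K P * ennreal (1 + 2 * R * \<alpha>\<^sup>2)" .
  qed
  finally show ?thesis unfolding R_def .
qed

text \<open>The union bound runs over (d + 1) d indices; a bound by a multiple of 5^d matches the
  summand d ln 5 in \<open>rho_mu\<close>, so that a single logarithm serves both summands of the
  radius.\<close>

lemma mult_Suc_le_5_power: "(d + 1) * d \<le> 2 * 5 ^ (d::nat)"
proof (induction d)
  case (Suc d)
  have "d \<le> 5 ^ d" "1 \<le> (5::nat) ^ d" by (simp_all add: less_imp_le)
  moreover have "(Suc d + 1) * Suc d = (d + 1) * d + 2 * d + 2" "2 * 5 ^ Suc d = 10 * (5::nat) ^ d"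
    by simp_all
  ultimately show ?case using Suc by linarith
qed simp

section \<open>The constants and the two regimes of the sample size\<close>

definition noise_const :: "real \<Rightarrow> real" where
  "noise_const \<tau> = exp 1 * (1 + \<tau>)"

text \<open>The factor next to 64 is the exponential moment bound B of \<open>fluct_props\<close>.
  With deviation \<epsilon> = sqrt s / (2 d^2) the optimal Bernstein exponent per sample is
  \<epsilon>^2 / (16 B), which is s times this constant.\<close>

definition rate_const :: "nat \<Rightarrow> real \<Rightarrow> real" where
  "rate_const d \<tau> = 1 / (64 * (exp (noise_const \<tau>) * noise_const \<tau>) * real d ^ 4)"

text \<open>Here \<open>s = L / (c N) \<le> 1\<close>. Bernstein's inequality gives deviations of order \<open>s\<^bsup>1/2\<^esup>\<close>, whereas
  \<open>\<rho>\<^sup>2 \<ge> s\<^bsup>2/d\<^esup> \<ge> s\<^bsup>1/2\<^esup>\<close>; this is the only place where the dimension has to be at least \<open>4\<close>.\<close>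

lemma moments_close_small_ratio:
  assumes d: "d \<ge> 4" and P: "P \<in> zero_mean_dists d" and EB: "square_exp_bound d P (noise_const \<tau>)"
    and N: "N \<ge> 1" and \<rho>: "root d (L / (rate_const d \<tau> * real N)) \<le> \<rho>"
    and L: "L > 0" "L \<le> rate_const d \<tau> * real N"
  shows "\<exists>E \<in> sets (\<Pi>\<^sub>M k\<in>{1..N}. P).
    measure (\<Pi>\<^sub>M k\<in>{1..N}. P) E \<ge> 1 - 4 * 5 ^ d * exp (- L) \<and>
    (\<forall>\<omega>\<in>E. \<forall>v. (\<integral>\<xi>. (lin d v \<xi>)\<^sup>2 \<partial>P)
        \<le> (\<Sum>k=1..N. (lin d v (centered d N \<omega> k))\<^sup>2) / real N + \<rho>\<^sup>2 / real d * sqn d v \<and>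
      (\<Sum>k=1..N. (lin d v (centered d N \<omega> k))\<^sup>2) / real N
        \<le> (\<integral>\<xi>. (lin d v \<xi>)\<^sup>2 \<partial>P) + \<rho>\<^sup>2 * sqn d v)"
proof -
  define B where "B = exp (noise_const \<tau>) * noise_const \<tau>"
  have B0: "1 \<le> noise_const \<tau>" using EB by (simp add: square_exp_bound_def)
  then have B: "1 \<le> B" unfolding B_def using mult_mono[of 1 "exp (noise_const \<tau>)" 1 "noise_const \<tau>"] by simp
  define c where "c = rate_const d \<tau>"
  define D where "D = real d"
  have D: "D \<ge> 1" using d by (simp add: D_def)
  have c: "c = 1 / (64 * B * D ^ 4)" by (simp add: c_def rate_const_def B_def D_def)
  have c0: "c > 0" using B D by (simp add: c)
  define s where "s = L / (c * real N)"
  have N0: "real N > 0" using N by simp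
  have s: "0 < s" "s \<le> 1" using L c0 N0 by (simp_all add: s_def c_def)
  have \<rho>s: "root d s \<le> \<rho>" using \<rho> by (simp add: s_def c_def)
  have \<rho>0: "\<rho> > 0" using \<rho>s s(1) d real_root_gt_zero[of d s] by linarith
  have sq: "sqrt s \<le> \<rho>\<^sup>2"
  \<comment> \<open>For \<rho> \<ge> 1 the bound s \<le> 1 suffices; for \<rho> < 1 powers decrease
    in the exponent, so s \<le> \<rho>^d \<le> \<rho>^4.\<close>
  proof (cases "\<rho> \<ge> 1")
    case True
    have "sqrt s \<le> 1" using s by simp
    also have "1 \<le> \<rho>\<^sup>2" using True by (simp add: one_le_power)
    finally show ?thesis .
  next
    case False
    have "s = root d s ^ d" using s d by simp
    also have "\<dots> \<le> \<rho> ^ d" using \<rho>s s(1) by (intro power_mono) (auto simp: real_root_ge_zero)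
    also have "\<dots> \<le> \<rho> ^ 4" using False \<rho>0 d by (intro power_decreasing) auto
    finally have "s \<le> (\<rho>\<^sup>2)\<^sup>2" by (simp add: power_mult[symmetric])
    then show ?thesis by (intro real_le_lsqrt) auto
  qed
  \<comment> \<open>Chosen so that 2 D \<epsilon> = sqrt s / D \<le> \<rho>^2 / D, where the 2
    covers \<epsilon> + \<epsilon>^2 for \<epsilon> \<le> 1.\<close>
  define \<epsilon> where "\<epsilon> = sqrt s / (2 * D\<^sup>2)"
  \<comment> \<open>This is \<epsilon> / (8 B), the maximiser of h \<epsilon> - 4 B h^2.\<close>
  define h where "h = sqrt s / (16 * B * D\<^sup>2)"
  have BD: "1 \<le> B * D\<^sup>2" using B D mult_mono[of 1 B 1 "D\<^sup>2"] by (simp add: one_le_power)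
  have s1: "sqrt s \<le> 1" "0 \<le> sqrt s" using s by auto
  have h: "0 \<le> h" "h \<le> 1 / 2"
  proof -
    show "0 \<le> h" using B s by (simp add: h_def)
    have "sqrt s * 2 \<le> 16 * (B * D\<^sup>2)" using BD s1 by linarith
    then show "h \<le> 1 / 2" using BD by (simp add: h_def pos_divide_le_eq mult_ac)
  qed
  have D2: "1 \<le> D\<^sup>2" using D by (simp add: one_le_power)
  have \<epsilon>0: "0 \<le> \<epsilon>" using s by (simp add: \<epsilon>_def)
  have "sqrt s \<le> 2 * D\<^sup>2" using s1 D2 by linarith
  then have \<epsilon>1: "\<epsilon> \<le> 1" using D by (simp add: \<epsilon>_def pos_divide_le_eq)
  have expo: "real N * (h * \<epsilon> - 4 * B * h\<^sup>2) = L"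
  proof -
    have ss: "sqrt s * sqrt s = s" using s by simp
    have "h * \<epsilon> = s / (32 * B * D ^ 4)"
      using ss by (simp add: h_def \<epsilon>_def power2_eq_square power4_eq_xxxx mult_ac)
    moreover have "4 * B * h\<^sup>2 = s / (64 * B * D ^ 4)"
      using ss B by (simp add: h_def power2_eq_square power4_eq_xxxx field_simps)
    ultimately have "h * \<epsilon> - 4 * B * h\<^sup>2 = s * c" by (simp add: c field_simps)
    then show ?thesis using N0 c0 by (simp add: s_def)
  qed
  obtain E where E: "E \<in> sets (\<Pi>\<^sub>M k\<in>{1..N}. P)"
      "measure (\<Pi>\<^sub>M k\<in>{1..N}. P) E \<ge> 1 - real ((d + 1) * d) * (2 * exp (- L))"
      "\<And>\<omega> t. \<omega> \<in> E \<Longrightarrow> t \<in> {..d} \<times> {..<d} \<Longrightarrow> \<bar>\<Sum>k=1..N. fluct d P t (\<omega> k)\<bar> \<le> real N * \<epsilon>"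
    using fluct_event[OF P EB h, of N \<epsilon>, folded B_def, unfolded expo] by blast
  have "real ((d + 1) * d) \<le> real (2 * 5 ^ d)" using mult_Suc_le_5_power[of d] of_nat_le_iff by blast
  then have "real ((d + 1) * d) * (2 * exp (- L)) \<le> real (2 * 5 ^ d) * (2 * exp (- L))"
    by (intro mult_right_mono) auto
  also have "\<dots> = 4 * 5 ^ d * exp (- L)" by simp
  finally have pr: "measure (\<Pi>\<^sub>M k\<in>{1..N}. P) E \<ge> 1 - 4 * 5 ^ d * exp (- L)"
    by (rule order_trans[OF diff_left_mono E(2)])
  have low: "D * (\<epsilon> + \<epsilon>\<^sup>2) \<le> \<rho>\<^sup>2 / D"
  proof -
    have "\<epsilon>\<^sup>2 \<le> \<epsilon>" using \<epsilon>0 \<epsilon>1 by (simp add: power2_eq_square mult_left_le)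
    then have "D * (\<epsilon> + \<epsilon>\<^sup>2) \<le> D * (2 * \<epsilon>)" using D by (intro mult_left_mono) auto
    also have "\<dots> = sqrt s / D" using D by (simp add: \<epsilon>_def power2_eq_square)
    also have "\<dots> \<le> \<rho>\<^sup>2 / D" using sq D by (intro divide_right_mono) auto
    finally show ?thesis .
  qed
  have "D * \<epsilon> \<le> D * (\<epsilon> + \<epsilon>\<^sup>2)" using D by (intro mult_left_mono) auto
  also note low
  also have "\<rho>\<^sup>2 / D \<le> \<rho>\<^sup>2" using D by (simp add: divide_le_eq mult_left_le mult_le_cancel_left1)
  finally have up: "D * \<epsilon> \<le> \<rho>\<^sup>2" .
  show ?thesis
  proof (intro bexI[OF _ E(1)] conjI ballI allI pr)
    fix \<omega> v assume w: "\<omega> \<in> E"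
    have cl: "(\<integral>\<xi>. (lin d v \<xi>)\<^sup>2 \<partial>P)
        \<le> (\<Sum>k=1..N. (lin d v (centered d N \<omega> k))\<^sup>2) / real N + D * (\<epsilon> + \<epsilon>\<^sup>2) * sqn d v"
      "(\<Sum>k=1..N. (lin d v (centered d N \<omega> k))\<^sup>2) / real N
        \<le> (\<integral>\<xi>. (lin d v \<xi>)\<^sup>2 \<partial>P) + D * \<epsilon> * sqn d v"
      unfolding D_def by (rule second_moments_close[OF P EB N \<epsilon>0], rule E(3)[OF w], assumption)+
    have "D * (\<epsilon> + \<epsilon>\<^sup>2) * sqn d v \<le> \<rho>\<^sup>2 / D * sqn d v" by (intro mult_right_mono low) simp
    then show "(\<integral>\<xi>. (lin d v \<xi>)\<^sup>2 \<partial>P)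
        \<le> (\<Sum>k=1..N. (lin d v (centered d N \<omega> k))\<^sup>2) / real N + \<rho>\<^sup>2 / real d * sqn d v"
      using cl(1) unfolding D_def[symmetric] by linarith
    have "D * \<epsilon> * sqn d v \<le> \<rho>\<^sup>2 * sqn d v" by (intro mult_right_mono up) simp
    then show "(\<Sum>k=1..N. (lin d v (centered d N \<omega> k))\<^sup>2) / real N
        \<le> (\<integral>\<xi>. (lin d v \<xi>)\<^sup>2 \<partial>P) + \<rho>\<^sup>2 * sqn d v"
      using cl(2) by linarith
  qed
qed

text \<open>Here \<open>\<rho>\<^sup>2\<close> already exceeds the crude exponential bound for the mean of \<open>\<parallel>\<xi>\<parallel>\<^sup>2\<close>, and no
  cancellation is needed.\<close>

lemma moments_close_large_ratio:
  assumes d: "d > 0" and P: "P \<in> zero_mean_dists d" and EB: "square_exp_bound d P (noise_const \<tau>)"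
    and N: "N \<ge> 1" and \<rho>: "real d * (1 + noise_const \<tau> / rate_const d \<tau>) * L / real N \<le> \<rho>\<^sup>2"
    and L: "L > 0" "rate_const d \<tau> * real N \<le> L"
  shows "\<exists>E \<in> sets (\<Pi>\<^sub>M k\<in>{1..N}. P).
    measure (\<Pi>\<^sub>M k\<in>{1..N}. P) E \<ge> 1 - exp (- L) \<and>
    (\<forall>\<omega>\<in>E. \<forall>v. (\<integral>\<xi>. (lin d v \<xi>)\<^sup>2 \<partial>P)
        \<le> (\<Sum>k=1..N. (lin d v (centered d N \<omega> k))\<^sup>2) / real N + \<rho>\<^sup>2 / real d * sqn d v \<and>
      (\<Sum>k=1..N. (lin d v (centered d N \<omega> k))\<^sup>2) / real N
        \<le> (\<integral>\<xi>. (lin d v \<xi>)\<^sup>2 \<partial>P) + \<rho>\<^sup>2 * sqn d v)"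
proof -
  define B0 where "B0 = noise_const \<tau>"
  define c where "c = rate_const d \<tau>"
  define T where "T = \<rho>\<^sup>2 / real d"
  have B0: "1 \<le> B0" using EB by (simp add: square_exp_bound_def B0_def)
  have c0: "c > 0" using B0 d by (simp add: c_def rate_const_def B0_def)
  have N0: "real N > 0" using N by simp
  have d1: "real d \<ge> 1" using d by simp
  have T\<rho>: "T \<le> \<rho>\<^sup>2" using d1 by (simp add: T_def divide_le_eq mult_le_cancel_left1)
  have NL: "real N \<le> L / c" using L(2) c0 by (simp add: c_def pos_le_divide_eq mult.commute)
  have "(1 + B0 / c) * L \<le> real N * T"
    using \<rho> N0 d1 by (simp add: T_def B0_def c_def field_simps)
  moreover have "B0 * real N \<le> B0 * (L / c)" using NL B0 by (intro mult_left_mono) auto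
  \<comment> \<open>The summand \<open>L\<close> becomes the probability exponent;
    \<open>B0 * real N\<close> compensates the factor \<open>B0 ^ N\<close> of the Chernoff bound
    and also gives \<open>B0 \<le> T\<close>.\<close>
  ultimately have NT: "L + B0 * real N \<le> real N * T" by (simp add: distrib_right)
  then have "B0 * real N \<le> T * real N" using L(1) by (simp add: mult.commute)
  then have BT: "B0 \<le> T" using N0 by simp
  obtain E where E: "E \<in> sets (\<Pi>\<^sub>M k\<in>{1..N}. P)"
      "measure (\<Pi>\<^sub>M k\<in>{1..N}. P) E \<ge> 1 - exp (- (real N * T)) * B0 ^ N"
      "\<And>\<omega>. \<omega> \<in> E \<Longrightarrow> (\<Sum>k=1..N. sqn d (\<omega> k)) \<le> real N * T"
    using sqn_event[OF P EB, of N "real N * T", folded B0_def] by blast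
  have "B0 ^ N \<le> exp B0 ^ N"
    using B0 exp_ge_add_one_self[of B0] by (intro power_mono) linarith+
  then have "exp (- (real N * T)) * B0 ^ N \<le> exp (- (real N * T)) * exp (real N * B0)"
    by (intro mult_left_mono) (auto simp: exp_of_nat_mult)
  also have "\<dots> \<le> exp (- L)" using NT by (simp add: exp_add[symmetric] mult.commute)
  finally have pr: "measure (\<Pi>\<^sub>M k\<in>{1..N}. P) E \<ge> 1 - exp (- L)" using E(2) by linarith
  show ?thesis
  proof (intro bexI[OF _ E(1)] conjI ballI allI pr)
    fix \<omega> v assume w: "\<omega> \<in> E"
    let ?mh = "(\<Sum>k=1..N. (lin d v (centered d N \<omega> k))\<^sup>2) / real N"
    have "(\<integral>\<xi>. (lin d v \<xi>)\<^sup>2 \<partial>P) \<le> B0 * sqn d v"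
      unfolding B0_def by (rule integral_lin_power2_le[OF P EB])
    also have "\<dots> \<le> T * sqn d v" by (intro mult_right_mono BT) simp
    finally have "(\<integral>\<xi>. (lin d v \<xi>)\<^sup>2 \<partial>P) \<le> T * sqn d v" .
    \<comment> \<open>The true moment alone is already below the slack, so nonnegativity is all that
      is asked of the empirical one.\<close>
    moreover have "0 \<le> ?mh" by (simp add: sum_nonneg)
    ultimately show "(\<integral>\<xi>. (lin d v \<xi>)\<^sup>2 \<partial>P) \<le> ?mh + \<rho>\<^sup>2 / real d * sqn d v"
      unfolding T_def by linarith
    have "?mh \<le> (\<Sum>k=1..N. sqn d (\<omega> k)) / real N * sqn d v" by (rule centered_second_moment_le[OF N])
    also have "\<dots> \<le> \<rho>\<^sup>2 * sqn d v"
    proof (intro mult_right_mono)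
      have "(\<Sum>k=1..N. sqn d (\<omega> k)) / real N \<le> T"
        using E(3)[OF w] N0 by (simp add: pos_divide_le_eq mult.commute)
      then show "(\<Sum>k=1..N. sqn d (\<omega> k)) / real N \<le> \<rho>\<^sup>2" using T\<rho> by linarith
    qed simp
    also have "\<dots> \<le> (\<integral>\<xi>. (lin d v \<xi>)\<^sup>2 \<partial>P) + \<rho>\<^sup>2 * sqn d v" by simp
    finally show "?mh \<le> (\<integral>\<xi>. (lin d v \<xi>)\<^sup>2 \<partial>P) + \<rho>\<^sup>2 * sqn d v" .
  qed
qed

text \<open>At confidence \<zeta> / 2 both logarithms in the radius equal \<open>L\<close>, and the
  third constant is chosen such that \<open>rho_mu\<close> equals sqrt (A L / N). Each branch of
  \<open>rho_w\<close> discards one nonnegative summand of the radius and feeds the other into the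
  matching regime.\<close>

lemma moments_close:
  assumes d: "d \<ge> 4" and \<gamma>: "\<gamma> > 2"
    and P: "P \<in> zero_mean_dists d" and EB: "square_exp_bound d P (noise_const \<tau>)"
    and N: "N \<ge> 1" and \<zeta>: "0 < \<zeta>" "\<zeta> \<le> 1"
    and \<rho>: "rho_star d \<gamma> \<tau> (2 * 5 ^ d) (rate_const d \<tau>)
      (4 * (K_const \<gamma> \<tau>)\<^sup>2 / (real d * (1 + noise_const \<tau> / rate_const d \<tau>))) N \<zeta> \<le> \<rho>"
  shows "\<rho> > 0" and "\<exists>E \<in> sets (\<Pi>\<^sub>M k\<in>{1..N}. P).
    measure (\<Pi>\<^sub>M k\<in>{1..N}. P) E \<ge> 1 - \<zeta> \<and>
    (\<forall>\<omega>\<in>E. \<forall>v. (\<integral>\<xi>. (lin d v \<xi>)\<^sup>2 \<partial>P)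
        \<le> (\<Sum>k=1..N. (lin d v (centered d N \<omega> k))\<^sup>2) / real N + \<rho>\<^sup>2 / real d * sqn d v \<and>
      (\<Sum>k=1..N. (lin d v (centered d N \<omega> k))\<^sup>2) / real N
        \<le> (\<integral>\<xi>. (lin d v \<xi>)\<^sup>2 \<partial>P) + \<rho>\<^sup>2 * sqn d v)"
proof -
  define B0 where "B0 = noise_const \<tau>"
  define c where "c = rate_const d \<tau>"
  define k where "k = (K_const \<gamma> \<tau>)\<^sup>2"
  define A where "A = real d * (1 + B0 / c)"
  define L where "L = ln (4 * 5 ^ d / \<zeta>)"
  have B0: "1 \<le> B0" using EB by (simp add: square_exp_bound_def B0_def)
  have d1: "real d \<ge> 1" using d by simp
  have c0: "c > 0" using B0 d by (simp add: c_def rate_const_def B0_def)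
  have A0: "A > 0" using B0 c0 d1 by (simp add: A_def add_pos_pos)
  have N0: "real N > 0" using N by simp
  \<comment> \<open>The maximum with 1 keeps \<open>K_const\<close> positive even when the logarithm
    of \<open>M_const\<close> is negative; otherwise it could not be cancelled in
    \<open>rho_mu\<close>.\<close>
  have k0: "k > 0"
  proof -
    have "0 < 2 / \<gamma> * max 1 (ln (M_const \<gamma> \<tau>) / ln 2)"
      using \<gamma> by (intro mult_pos_pos) (auto simp: less_max_iff_disj)
    then show ?thesis by (simp add: k_def K_const_def)
  qed
  have pos: "4 * 5 ^ d / \<zeta> > 0" using \<zeta> by simp
  \<comment> \<open>This holds up to \<zeta> = 1, so \<open>L\<close> is positive and neither
    \<open>root\<close> nor \<open>powr\<close> in \<open>rho_w\<close> receives a negative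
    argument.\<close>
  have "1 < 4 * 5 ^ d / \<zeta>"
  proof -
    have "\<zeta> < 4 * 1" using \<zeta> by simp
    also have "4 * 1 \<le> 4 * (5::real) ^ d" by (intro mult_left_mono one_le_power) auto
    finally show ?thesis using \<zeta> by simp
  qed
  then have L0: "L > 0" by (simp add: L_def)
  \<comment> \<open>The left-hand side is the failure probability of the regime with many
    samples.\<close>
  have eL: "4 * 5 ^ d * exp (- L) = \<zeta>" using pos \<zeta> by (simp add: L_def exp_minus field_simps)
  have w: "rho_w d \<gamma> (2 * 5 ^ d) c N (\<zeta> / 2)
    = (if real N \<ge> L / c then root d (L / (c * real N)) else (L / (c * real N)) powr (1 / \<gamma>))"
    by (simp add: rho_w_def L_def)
  have "ln (2 / (\<zeta> / 2)) + real d * ln 5 = L"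
    using \<zeta> by (simp add: L_def ln_div ln_mult ln_realpow)
  then have mu: "rho_mu d \<gamma> \<tau> (4 * k / A) N (\<zeta> / 2) = sqrt (A * L / real N)"
    using k0 by (simp add: rho_mu_def k_def[symmetric])
  have le: "rho_w d \<gamma> (2 * 5 ^ d) c N (\<zeta> / 2) + sqrt (A * L / real N) \<le> \<rho>"
    using \<rho> mu unfolding rho_star_def A_def k_def B0_def c_def by linarith
  have w0: "0 \<le> rho_w d \<gamma> (2 * 5 ^ d) c N (\<zeta> / 2)"
    unfolding w using L0 c0 N0 by (auto intro: real_root_ge_zero)
  have mu0: "0 < sqrt (A * L / real N)" using A0 L0 N0 by simp
  show \<rho>0: "\<rho> > 0" using le w0 mu0 by linarith
  show "\<exists>E \<in> sets (\<Pi>\<^sub>M k\<in>{1..N}. P).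
    measure (\<Pi>\<^sub>M k\<in>{1..N}. P) E \<ge> 1 - \<zeta> \<and>
    (\<forall>\<omega>\<in>E. \<forall>v. (\<integral>\<xi>. (lin d v \<xi>)\<^sup>2 \<partial>P)
        \<le> (\<Sum>k=1..N. (lin d v (centered d N \<omega> k))\<^sup>2) / real N + \<rho>\<^sup>2 / real d * sqn d v \<and>
      (\<Sum>k=1..N. (lin d v (centered d N \<omega> k))\<^sup>2) / real N
        \<le> (\<integral>\<xi>. (lin d v \<xi>)\<^sup>2 \<partial>P) + \<rho>\<^sup>2 * sqn d v)"
  proof (cases "real N \<ge> L / c")
    case True
    then have "rho_w d \<gamma> (2 * 5 ^ d) c N (\<zeta> / 2) = root d (L / (c * real N))" unfolding w by simp
    then have "root d (L / (c * real N)) \<le> \<rho>" using le mu0 by linarith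
    moreover have "L \<le> c * real N" using True c0 by (simp add: pos_divide_le_eq mult.commute)
    ultimately show ?thesis
      using moments_close_small_ratio[OF d P EB N _ L0, of \<rho>] unfolding c_def eL by blast
  next
    case False
    have "sqrt (A * L / real N) \<le> \<rho>" using le w0 by linarith
    then have "A * L / real N \<le> \<rho>\<^sup>2" using \<rho>0 by (simp add: sqrt_le_D)
    moreover have "c * real N \<le> L" using False c0 by (simp add: pos_divide_le_eq mult.commute)
    moreover have "1 - \<zeta> \<le> 1 - exp (- L)"
    proof -
      have "1 * exp (- L) \<le> 4 * 5 ^ d * exp (- L)"
      proof (rule mult_right_mono)
        have "1 \<le> (5::real) ^ d" by simp
        then show "1 \<le> 4 * (5::real) ^ d" by linarith
      qed simp
      then show ?thesis using eL by simp
    qed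
    moreover have "d > 0" using d by simp
    ultimately show ?thesis
      using moments_close_large_ratio[OF _ P EB N _ L0, of \<rho>]
      unfolding A_def c_def B0_def by (meson order_trans)
  qed
qed

theorem theorem1:
  fixes d :: nat and \<gamma> \<tau> :: real
  assumes "d > 4" and "\<gamma> > 2" and "\<tau> > 0"
  shows "\<exists>c1 > 0. \<exists>c2 > 0. \<exists>c3 > 0.
    \<forall>(S :: lq) (P :: (nat \<Rightarrow> real) measure) (N :: nat) (\<zeta> :: real) (\<rho> :: real) (Kopt :: real mat).
      lq_problem S \<longrightarrow> noise_dim S = d \<longrightarrow>
      P \<in> zero_mean_dists d \<longrightarrow>
      pd_mat d (cov_mat d P) \<longrightarrow>
      (\<integral>\<^sup>+ \<xi>. ennreal (exp (L2_set \<xi> {..<d} powr \<gamma>)) \<partial>P) \<le> ennreal \<tau> \<longrightarrow>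
      N \<ge> 1 \<longrightarrow> 0 < \<zeta> \<longrightarrow> \<zeta> \<le> 1 \<longrightarrow>
      rho_star d \<gamma> \<tau> c1 c2 c3 N \<zeta> \<le> \<rho> \<longrightarrow>
      Kopt \<in> oracle_controllers S P \<longrightarrow>
      (\<exists>E \<in> sets (\<Pi>\<^sub>M k\<in>{1..N}. P).
         measure (\<Pi>\<^sub>M k\<in>{1..N}. P) E \<ge> 1 - \<zeta> \<and>
         (\<forall>\<omega> \<in> E. \<forall>Kdr \<in> dr_controllers S \<rho> (centered_empirical d N \<omega>).
            let \<alpha> = lambda_min (cov_mat d P) powr (- 1 / 2);
                \<beta> = lambda_max (cov_mat d (centered_empirical d N \<omega>)) powr (1 / 2);
                \<rho>_bar = \<rho> * (2 * \<beta> + \<rho>)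
            in J S Kdr P \<le> J S Kopt P * ennreal (1 + 2 * \<rho>_bar * \<alpha>\<^sup>2)))"
proof -
  let ?c2 = "rate_const d \<tau>"
  let ?c3 = "4 * (K_const \<gamma> \<tau>)\<^sup>2 / (real d * (1 + noise_const \<tau> / ?c2))"
  have nc: "noise_const \<tau> > 0" using assms(3) by (simp add: noise_const_def)
  then have c2: "?c2 > 0" using assms(1) by (simp add: rate_const_def)
  have "0 < 2 / \<gamma> * max 1 (ln (M_const \<gamma> \<tau>) / ln 2)"
    using assms(2) by (intro mult_pos_pos) (auto simp: less_max_iff_disj)
  then have "(K_const \<gamma> \<tau>)\<^sup>2 > 0" by (simp add: K_const_def)
  then have c3: "?c3 > 0" using nc c2 assms(1) by (auto intro!: divide_pos_pos mult_pos_pos add_pos_pos)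
  show ?thesis
  proof (rule exI[of _ "2 * 5 ^ d"], intro conjI, simp, rule exI[of _ ?c2], intro conjI c2,
      rule exI[of _ ?c3], intro conjI c3 allI impI)
    fix S P N \<zeta> \<rho> Kopt
    assume S: "lq_problem S" "noise_dim S = d" and P: "P \<in> zero_mean_dists d"
      and pd: "pd_mat d (cov_mat d P)"
      and E: "(\<integral>\<^sup>+ \<xi>. ennreal (exp (L2_set \<xi> {..<d} powr \<gamma>)) \<partial>P) \<le> ennreal \<tau>"
      and N: "N \<ge> (1::nat)" and \<zeta>: "0 < \<zeta>" "\<zeta> \<le> 1"
      and \<rho>: "rho_star d \<gamma> \<tau> (2 * 5 ^ d) ?c2 ?c3 N \<zeta> \<le> \<rho>"
      and Kopt: "Kopt \<in> oracle_controllers S P"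
    have EB: "square_exp_bound d P (noise_const \<tau>)"
      unfolding noise_const_def using P
      by (intro square_exp_bound_of_powr[OF assms(2,3) _ E]) (simp add: zero_mean_dists_def)
    have d: "d \<ge> 4" "d > 0" using assms(1) by auto
    have K: "Kopt \<in> causal S" using Kopt by (simp add: oracle_controllers_def is_arg_min_def)
    \<comment> \<open>The resulting event depends neither on the system nor on a controller, so it
      serves every sample-dependent \<open>Kdr\<close> at once.\<close>
    note mc = moments_close[OF d(1) assms(2) P EB N \<zeta> \<rho>]
    obtain E where E: "E \<in> sets (\<Pi>\<^sub>M k\<in>{1..N}. P)" "measure (\<Pi>\<^sub>M k\<in>{1..N}. P) E \<ge> 1 - \<zeta>"
      and close: "\<And>\<omega> v. \<omega> \<in> E \<Longrightarrow> (\<integral>\<xi>. (lin d v \<xi>)\<^sup>2 \<partial>P)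
          \<le> (\<Sum>k=1..N. (lin d v (centered d N \<omega> k))\<^sup>2) / real N + \<rho>\<^sup>2 / real d * sqn d v"
        "\<And>\<omega> v. \<omega> \<in> E \<Longrightarrow> (\<Sum>k=1..N. (lin d v (centered d N \<omega> k))\<^sup>2) / real N
          \<le> (\<integral>\<xi>. (lin d v \<xi>)\<^sup>2 \<partial>P) + \<rho>\<^sup>2 * sqn d v"
      using mc(2) by blast
    show "\<exists>E \<in> sets (\<Pi>\<^sub>M k\<in>{1..N}. P).
         measure (\<Pi>\<^sub>M k\<in>{1..N}. P) E \<ge> 1 - \<zeta> \<and>
         (\<forall>\<omega> \<in> E. \<forall>Kdr \<in> dr_controllers S \<rho> (centered_empirical d N \<omega>).
            let \<alpha> = lambda_min (cov_mat d P) powr (- 1 / 2);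
                \<beta> = lambda_max (cov_mat d (centered_empirical d N \<omega>)) powr (1 / 2);
                \<rho>_bar = \<rho> * (2 * \<beta> + \<rho>)
            in J S Kdr P \<le> J S Kopt P * ennreal (1 + 2 * \<rho>_bar * \<alpha>\<^sup>2))"
      unfolding Let_def
      by (intro bexI[OF _ E(1)] conjI ballI E(2), rule dr_cost_bound[OF S d(2) P pd _ N mc(1)])
        (use integrable_prod[OF P EB] close K in auto)
  qed
qed

end
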